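(* Problem 1B in the presence of possibly complex minimum-phase invariant zeros (stated in the context) is solvable if and only if there exist $\nu_{0,0},\nu_{0,1},\nu_{0,3},\ldots,\nu_{0,2c-1}\in\mathbb N$ such that $\nu_{0,0}+2\nu_{0,1}+2\nu_{0,3}+\cdots+2\nu_{0,2c-1}=\nu_0$ and $$\dim\Big(\sum_{i\in Q_0}\mathcal E_{g,0}+\sum_{i\in Q}\mathcal E_{g,i}+\sum_{i\in Q'}\overline{\mathcal E}_{g,i}+\sum_{(i,j)\in P}\mathcal R_i^c(\lambda_{i,j})\Big)\ge\sum_{i\in Q_0}\nu_{0,i}+\sum_{i\in Q}\nu_{0,i}+\sum_{i\in Q'}\nu_{0,i}+\operatorname{card}P$$ for all $Q_0\in2^{J_0}$ with $J_0=\{0\}$, all $Q,Q'\in2^J$ with $J=\{1,3,\ldots,2c-1\}$, and all $P\in2^I$ with $I=\{(1,1),\ldots,(1,\nu_1),\ldots,(p,1),\ldots,(p,\nu_p)\}$, where $\mathcal R_i^c(\lambda_{i,j})=\operatorname{span}_{\mathbb C}\widehat R_i(\lambda_{i,j})$ and dimensions are over $\mathbb C$.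
   Context: System: $\Sigma=(A,B,C,D)$ is $\mathcal D x=Ax+Bu$, $y=Cx+Du$, $x(t)\in\mathbb R^n$, $u(t)\in\mathbb R^m$, $y(t)\in\mathbb R^p$, real matrices; $\mathcal D x=\dot x$ (continuous time) or $x(t+1)$ (discrete time). $\mathbb C_g$ is the open left half-plane (continuous) or open unit disc (discrete), $\mathbb R_g=\mathbb C_g\cap\mathbb R$. $\mathcal Z$ is the set of invariant zeros of $\Sigma$: those $\lambda\in\mathbb C$ at which the rank of $\begin{bmatrix}A-\lambda I&B\\C&D\end{bmatrix}$ is below its normal rank; minimum-phase zeros are those in $\mathbb C_g$. $\mathcal Z_{g,\mathbb C}$ is the set of invariant zeros in $\mathbb C_g\setminus\mathbb R$, consisting of $c$ complex conjugate pairs, indexed as $z_1,\ldots,z_{2c}$ with $z_{i+1}=\overline z_i$ for odd $i$. Standing assumptions: $\Sigma$ is right invertible (that matrix pencil has full row rank for all but finitely many $\lambda$), stabilizable, with no invariant zero at $0$ (continuous) or $1$ (discrete); algebraic and geometric multiplicities of each minimum-phase invariant zero coincide; no Jordan chains are allowed in the closed loop ($A+BF$ diagonalizable). The freely assigned eigenvalues are real, but minimum-phase invariant zeros may be complex. $\mathbb N$ includes $0$. Control: $u=Fx+Gr$, $F$ real with $\sigma(A+BF)\subset\mathbb C_g$, $G$ a right inverse of the closed-loop static gain. For constant $r$, $\epsilon=y-r$ satisfies $\mathcal D\xi=(A+BF)\xi$, $\epsilon=(C+DF)\xi$. State-to-output decoupling: for any initial condition, $\epsilon_i(t)=\sum_{j=1}^{\nu_i}\beta_{i,j}e^{\lambda_{i,j}t}$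 (resp. $\sum_j\beta_{i,j}\lambda_{i,j}^t$), $i=1,\ldots,p$, where the $\lambda_{i,j}$ are the observable closed-loop eigenvalues and the $\beta_{i,j}$ can be made arbitrary by choice of $\xi(0)$ (subject to $\beta_{i,k}=\overline\beta_{i,j}$ for conjugate pairs $\lambda_{i,k}=\overline\lambda_{i,j}$). That is, $A+BF$ has a basis of eigenvectors $v_{0,1},\ldots,v_{0,\nu_0},v_{1,1},\ldots,v_{p,\nu_p}$ (real for real eigenvalues, in conjugate pairs otherwise) with eigenvalues $\lambda_{i,j}$ such that $(C+DF)v_{0,j}=0$ and $(C+DF)v_{i,j}$ is a nonzero multiple of the $i$-th canonical vector $e_i\in\mathbb R^p$ for $i\ge1$; the $\lambda_{i,j}$ ($1\le j\le\nu_i$) are the eigenvalues observable from $\epsilon_i$ and the $\lambda_{0,j}$ the unobservable ones. Problem 1B: given nonnegative integers $\nu_1,\ldots,\nu_p$ with $\nu_0=n-\sum_i\nu_i\ge0$ and assigned $\lambda_{i,j}\in\mathbb R_g\setminus\mathcal Z$ ($i=1,\ldots,p$, $j=1,\ldots,\nu_i$), find $F,G$ such that: (1) $y(t)\to\bar r$ for every constant reference $r(t)=\bar r$; (2) state-to-output decoupling is achieved; (3) from each $\epsilon_i$ exactly $\nu_i$ eigenvalues are observable and they are not invariant zeros; and the eigenvalues observable from $\epsilon_i$ are exactly $\{\lambda_{i,j}\}_{j=1,\ldots,\nu_i}$, while the unobservable ones are not assigned a priori (they lie in $\mathbb C_g$ and may be invariant zeros). Solvable means such $F,G$ exist. Sets: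 for $\lambda\in\mathbb C$, $\mathcal R(\lambda)=\{v\in\mathbb C^n\mid\exists w\in\mathbb C^m:\ (A-\lambda I)v+Bw=0,\ Cv+Dw=0\}$ and $\widehat R_i(\lambda)=\{v\in\mathbb C^n\mid\exists w\in\mathbb C^m,\ \exists\delta\in\mathbb R\setminus\{0\}:\ (A-\lambda I)v+Bw=0,\ Cv+Dw=\delta e_i\}$. $E_{g,0}=\bigcup_{\lambda\in\mathbb C_g\setminus\mathcal Z_{g,\mathbb C}}\mathcal R(\lambda)$, $E_{g,i}=\mathcal R(z_i)$ for $i=1,\ldots,2c$, so that $E_{g,i+1}=\overline{E}_{g,i}$ for odd $i$; $\mathcal E_{g,i}=\operatorname{span}_{\mathbb C}E_{g,i}$ and $\overline{\mathcal E}_{g,i}$ is its complex conjugate. *)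

theory Defs
  imports "HOL-Analysis.Analysis" "HOL-Computational_Algebra.Field_as_Ring" "HOL-Computational_Algebra.Polynomial_Factorial"
begin

abbreviation cmat :: "real^'a^'b \<Rightarrow> complex^'a^'b" where
  "cmat \<equiv> map_matrix complex_of_real"

definition cnj_vec :: "complex^'a \<Rightarrow> complex^'a" where
  "cnj_vec v = (\<chi> k. cnj (v $ k))"

definition eigenvalues :: "real^'n^'n \<Rightarrow> complex set" where
  "eigenvalues M = {s. \<exists>v. v \<noteq> 0 \<and> cmat M *v v = s *s v}"

definition eval_mat :: "complex poly^'c^'r \<Rightarrow> complex \<Rightarrow> complex^'c^'r" where
  "eval_mat M s = map_matrix (\<lambda>q. poly q s) M"

text \<open>The maximum over \<open>s\<close> agrees with the rank over the field of rational functions.\<close>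

definition normal_rank :: "complex poly^'c::finite^'r::finite \<Rightarrow> nat" where
  "normal_rank M = Max (range (\<lambda>s. rank (eval_mat M s)))"

text \<open>Minors of order \<open>k\<close>, by the Leibniz formula. The injections \<open>f\<close> and \<open>g\<close> select rows and
  columns in an arbitrary order, which affects a minor only by its sign.\<close>

definition minors :: "nat \<Rightarrow> complex poly^'c^'r \<Rightarrow> complex poly set" where
  "minors k M = {(\<Sum>\<pi> | \<pi> permutes {..<k}. of_int (sign \<pi>) * (\<Prod>i<k. M $ f i $ g (\<pi> i))) | f g.
     inj_on f {..<k} \<and> inj_on g {..<k}}"

definition determinantal_divisor :: "nat \<Rightarrow> complex poly^'c^'r \<Rightarrow> complex poly" where
  "determinantal_divisor k M = Gcd (minors k M)"

text \<open>The diagonal entries of the Smith form, for \<open>1 \<le> k \<le> normal_rank M\<close>. The elementary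
  divisors at \<open>s\<close> are the nontrivial factors \<open>(x - s) ^ order s (invariant_polynomial k M)\<close>.\<close>

definition invariant_polynomial :: "nat \<Rightarrow> complex poly^'c^'r \<Rightarrow> complex poly" where
  "invariant_polynomial k M = determinantal_divisor k M div determinantal_divisor (k - 1) M"

definition algebraic_multiplicity :: "complex \<Rightarrow> complex poly^'c::finite^'r::finite \<Rightarrow> nat" where
  "algebraic_multiplicity s M = (\<Sum>k = 1..normal_rank M. order s (invariant_polynomial k M))"

definition geometric_multiplicity :: "complex \<Rightarrow> complex poly^'c::finite^'r::finite \<Rightarrow> nat" where
  "geometric_multiplicity s M = normal_rank M - rank (eval_mat M s)"

datatype time_domain = Continuous | Discrete

definition stable_region :: "time_domain \<Rightarrow> complex set" where
  "stable_region T = (case T of Continuous \<Rightarrow> {s. Re s < 0} | Discrete \<Rightarrow> {s. cmod s < 1})"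

text \<open>The value of \<open>s\<close> at which a transfer function yields the static gain.\<close>

definition dc_point :: "time_domain \<Rightarrow> real" where
  "dc_point T = (case T of Continuous \<Rightarrow> 0 | Discrete \<Rightarrow> 1)"

definition system_pencil ::
  "real^'n^'n \<Rightarrow> real^'m^'n \<Rightarrow> real^'n^'p \<Rightarrow> real^'m^'p \<Rightarrow> complex poly^('n + 'm)^('n + 'p)" where
  "system_pencil A B C D = (\<chi> r c. case (r, c) of
      (Inl i, Inl j) \<Rightarrow> [:complex_of_real (A $ i $ j), if i = j then -1 else 0:]
    | (Inl i, Inr k) \<Rightarrow> [:complex_of_real (B $ i $ k):]
    | (Inr l, Inl j) \<Rightarrow> [:complex_of_real (C $ l $ j):]
    | (Inr l, Inr k) \<Rightarrow> [:complex_of_real (D $ l $ k):])"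

definition invariant_zeros ::
  "real^'n^'n \<Rightarrow> real^'m^'n \<Rightarrow> real^'n^'p \<Rightarrow> real^'m^'p \<Rightarrow> complex set" where
  "invariant_zeros A B C D =
     {s. rank (eval_mat (system_pencil A B C D) s) < normal_rank (system_pencil A B C D)}"

definition nonreal_minimum_phase_zeros ::
  "time_domain \<Rightarrow> real^'n^'n \<Rightarrow> real^'m^'n \<Rightarrow> real^'n^'p \<Rightarrow> real^'m^'p \<Rightarrow> complex set" where
  "nonreal_minimum_phase_zeros T A B C D = invariant_zeros A B C D \<inter> stable_region T - \<real>"

definition right_invertible ::
  "real^'n^'n \<Rightarrow> real^'m^'n \<Rightarrow> real^'n^'p \<Rightarrow> real^'m^'p \<Rightarrow> bool" where
  "right_invertible A B C D \<longleftrightarrow>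
     finite {s. rank (eval_mat (system_pencil A B C D) s) \<noteq> CARD('n) + CARD('p)}"

definition stabilizable :: "time_domain \<Rightarrow> real^'n^'n \<Rightarrow> real^'m^'n \<Rightarrow> bool" where
  "stabilizable T A B \<longleftrightarrow> (\<exists>F :: real^'n^'m. eigenvalues (A + B ** F) \<subseteq> stable_region T)"

definition static_gain ::
  "time_domain \<Rightarrow> real^'n^'n \<Rightarrow> real^'m^'n \<Rightarrow> real^'n^'p \<Rightarrow> real^'m^'p \<Rightarrow> real^'n^'m \<Rightarrow> real^'m^'p" where
  "static_gain T A B C D F =
     (C + D ** F) ** matrix_inv (mat (dc_point T) - (A + B ** F)) ** B + D"

definition tracks_constant_references ::
  "time_domain \<Rightarrow> real^'n^'n \<Rightarrow> real^'m^'n \<Rightarrow> real^'n^'p \<Rightarrow> real^'m^'p \<Rightarrow>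
   real^'n^'m \<Rightarrow> real^'p^'m \<Rightarrow> bool" where
  "tracks_constant_references T A B C D F G \<longleftrightarrow> (case T of
      Continuous \<Rightarrow> \<forall>r. \<forall>x :: real \<Rightarrow> real^'n.
        (\<forall>t\<ge>0. (x has_vector_derivative A *v x t + B *v (F *v x t + G *v r)) (at t within {0..})) \<longrightarrow>
        ((\<lambda>t. C *v x t + D *v (F *v x t + G *v r)) \<longlongrightarrow> r) at_top
    | Discrete \<Rightarrow> \<forall>r. \<forall>x :: nat \<Rightarrow> real^'n.
        (\<forall>t. x (Suc t) = A *v x t + B *v (F *v x t + G *v r)) \<longrightarrow>
        (\<lambda>t. C *v x t + D *v (F *v x t + G *v r)) \<longlonglongrightarrow> r)"

text \<open>The closed-loop eigenvectors \<open>v k j\<close>, \<open>1 \<le> j \<le> N k\<close>, with eigenvalues \<open>ev k j\<close>, form a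
  basis of \<open>\<complex>\<^sup>n\<close>. The group \<open>k = None\<close> is unobservable (index \<open>0\<close> in the usual numbering), and
  the group \<open>k = Some i\<close> is observable from the \<open>i\<close>-th component of the tracking error only.\<close>

definition decoupling_eigenbasis ::
  "real^'n^'n \<Rightarrow> real^'m^'n \<Rightarrow> real^'n^'p \<Rightarrow> real^'m^'p \<Rightarrow> real^'n^'m \<Rightarrow>
   ('p option \<Rightarrow> nat) \<Rightarrow> ('p option \<Rightarrow> nat \<Rightarrow> complex) \<Rightarrow> ('p option \<Rightarrow> nat \<Rightarrow> complex^'n) \<Rightarrow> bool" where
  "decoupling_eigenbasis A B C D F N ev v \<longleftrightarrow>
     (let K = (SIGMA k:UNIV. {1..N k}) in
        inj_on (\<lambda>(k, j). v k j) K \<and>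
        vec.independent ((\<lambda>(k, j). v k j) ` K) \<and>
        vec.span ((\<lambda>(k, j). v k j) ` K) = UNIV) \<and>
     (\<forall>k. \<forall>j\<in>{1..N k}. cmat (A + B ** F) *v v k j = ev k j *s v k j) \<and>
     (\<forall>k. \<forall>j\<in>{1..N k}. ev k j \<in> \<real> \<longrightarrow> cnj_vec (v k j) = v k j) \<and>
     (\<forall>k. \<forall>j\<in>{1..N k}. ev k j \<notin> \<real> \<longrightarrow>
        (\<exists>j'\<in>{1..N k}. ev k j' = cnj (ev k j) \<and> v k j' = cnj_vec (v k j))) \<and>
     (\<forall>j\<in>{1..N None}. cmat (C + D ** F) *v v None j = 0) \<and>
     (\<forall>i. \<forall>j\<in>{1..N (Some i)}.
        \<exists>\<delta>. \<delta> \<noteq> 0 \<and> cmat (C + D ** F) *v v (Some i) j = \<delta> *s axis i 1)"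

definition problem_1B_solvable ::
  "time_domain \<Rightarrow> real^'n^'n \<Rightarrow> real^'m^'n \<Rightarrow> real^'n^'p \<Rightarrow> real^'m^'p \<Rightarrow>
   nat \<Rightarrow> ('p \<Rightarrow> nat) \<Rightarrow> ('p \<Rightarrow> nat \<Rightarrow> real) \<Rightarrow> bool" where
  "problem_1B_solvable T A B C D \<nu>0 \<nu> lam \<longleftrightarrow>
     (\<exists>(F :: real^'n^'m) (G :: real^'p^'m).
        eigenvalues (A + B ** F) \<subseteq> stable_region T \<and>
        static_gain T A B C D F ** G = mat 1 \<and>
        tracks_constant_references T A B C D F G \<and>
        (\<exists>ev v. decoupling_eigenbasis A B C D F (case_option \<nu>0 \<nu>) ev v \<and>
           (\<forall>i. \<forall>j\<in>{1..\<nu> i}. ev (Some i) j = complex_of_real (lam i j)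
              \<and> ev (Some i) j \<notin> invariant_zeros A B C D)))"

definition \<R> ::
  "real^'n^'n \<Rightarrow> real^'m^'n \<Rightarrow> real^'n^'p \<Rightarrow> real^'m^'p \<Rightarrow> complex \<Rightarrow> (complex^'n) set" where
  "\<R> A B C D s = {v. \<exists>w :: complex^'m.
     (cmat A - mat s) *v v + cmat B *v w = 0 \<and> cmat C *v v + cmat D *v w = 0}"

definition R_hat ::
  "real^'n^'n \<Rightarrow> real^'m^'n \<Rightarrow> real^'n^'p \<Rightarrow> real^'m^'p \<Rightarrow> 'p \<Rightarrow> complex \<Rightarrow> (complex^'n) set" where
  "R_hat A B C D i s = {v. \<exists>(w :: complex^'m) (\<delta> :: real). \<delta> \<noteq> 0 \<and>
     (cmat A - mat s) *v v + cmat B *v w = 0 \<and>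
     cmat C *v v + cmat D *v w = complex_of_real \<delta> *s axis i 1}"

definition R_c ::
  "real^'n^'n \<Rightarrow> real^'m^'n \<Rightarrow> real^'n^'p \<Rightarrow> real^'m^'p \<Rightarrow> 'p \<Rightarrow> complex \<Rightarrow> (complex^'n) set" where
  "R_c A B C D i s = vec.span (R_hat A B C D i s)"

definition E_g ::
  "time_domain \<Rightarrow> real^'n^'n \<Rightarrow> real^'m^'n \<Rightarrow> real^'n^'p \<Rightarrow> real^'m^'p \<Rightarrow>
   (nat \<Rightarrow> complex) \<Rightarrow> nat \<Rightarrow> (complex^'n) set" where
  "E_g T A B C D z i =
     (if i = 0
      then \<Union>s \<in> stable_region T - nonreal_minimum_phase_zeros T A B C D. \<R> A B C D s
      else \<R> A B C D (z i))"

text \<open>Sums of these subspaces are Minkowski sums in the sense of \<^theory>\<open>HOL-Library.Set_Algebras\<close>,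
  where the empty sum is \<open>{0}\<close>.\<close>

definition \<E> ::
  "time_domain \<Rightarrow> real^'n^'n \<Rightarrow> real^'m^'n \<Rightarrow> real^'n^'p \<Rightarrow> real^'m^'p \<Rightarrow>
   (nat \<Rightarrow> complex) \<Rightarrow> nat \<Rightarrow> (complex^'n) set" where
  "\<E> T A B C D z i = vec.span (E_g T A B C D z i)"

end

theory Submission
  imports Defs "HOL-Real_Asymp.Real_Asymp"
begin

text \<open>
  A feedback with the required properties amounts to a basis of eigenvectors taken from the sets
  \<open>\<R>\<close> and \<open>R_hat\<close> and closed under conjugation, because the inputs \<open>w\<close> attached to the
  basis vectors \<open>v\<close> determine \<open>F\<close> by \<open>F v = w\<close>. Necessity of the dimension condition is a
  count of independent vectors. For sufficiency, Rado's theorem on independent transversals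
  yields a basis with vectors in the prescribed sets, and two facts make it closed under
  conjugation. First, by right invertibility each kernel vector of the pencil at a nonreal
  number that is not a zero extends to a polynomial kernel vector and so lies in the span of the
  kernel vectors at real stable numbers. The vectors that do not belong to nonreal zeros can
  thus be taken real. Second, a pair of basis vectors, one in \<open>\<R>\<close> at a nonreal zero and one in
  the conjugate space, can be exchanged for a pair of conjugate vectors.
\<close>

section \<open>Rado's theorem\<close>

text \<open>The obstacle is that Rado's theorem picks each vector on its own, whereas a real
  \<open>F\<close> forces eigenvectors and inputs to be closed under conjugation. At a nonreal zero
  the pencil loses rank, so a kernel vector there need not lie in the span of kernel vectors at
  other points and cannot be traded for real ones. This is why the condition treats nonreal zeros
  apart, with one index set for the space at \<open>z i\<close> and another for its conjugate: the
  two members of a pair enter Rado's family separately and come out unrelated. The exchange changes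
  only these two vectors, so the pairs can be repaired one after the other. The remaining
  unobservable eigenvalues are not prescribed. Hence only the span of the admissible vectors
  matters, not the number at which a vector is a kernel vector, and this makes the passage to real
  numbers harmless. In the other direction, conjugation maps the eigenvectors at \<open>z i\<close>
  injectively to those at the conjugate number, so both numbers occur equally often and one count
  \<mu> i serves for the pair.\<close>

lemma dim_Un_submodular:
  fixes X Y U :: "('a::field^'n) set"
  assumes "U \<subseteq> vec.span X" "U \<subseteq> vec.span Y"
  shows "vec.dim (X \<union> Y) + vec.dim U \<le> vec.dim X + vec.dim Y"
proof -
  have "vec.dim U \<le> vec.dim (vec.span X \<inter> vec.span Y)"
    using assms by (intro vec.dim_subset) auto
  moreover have "vec.dim (X \<union> Y) = vec.dim {x + y |x y. x \<in> vec.span X \<and> y \<in> vec.span Y}"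
    by (simp add: vec.span_Un[symmetric])
  moreover have "vec.dim {x + y |x y. x \<in> vec.span X \<and> y \<in> vec.span Y}
      + vec.dim (vec.span X \<inter> vec.span Y) = vec.dim X + vec.dim Y"
    using vec.dim_sums_Int[OF vec.subspace_span vec.subspace_span, of X Y] by simp
  ultimately show ?thesis by linarith
qed

text \<open>The dimension is at most the size of the image, which is at most \<open>card I\<close>;
  the assumption turns both into equalities. The second gives injectivity, the first
  independence.\<close>

lemma independent_family_if_dim:
  fixes x :: "'i \<Rightarrow> 'a::field^'n"
  assumes "finite I" "card I \<le> vec.dim (x ` I)"
  shows "inj_on x I \<and> vec.independent (x ` I)"
proof -
  have le: "vec.dim (x ` I) \<le> card (x ` I)"
    using assms(1) by (intro vec.dim_le_card vec.span_superset) auto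
  moreover have "card (x ` I) \<le> card I"
    using assms(1) by (rule card_image_le)
  ultimately have eq: "card (x ` I) = card I" "card (x ` I) = vec.dim (x ` I)"
    using assms(2) by linarith+
  have "inj_on x I"
    using assms(1) eq(1) by (rule eq_card_imp_inj_on)
  moreover have "vec.independent (x ` I)"
    using vec.card_eq_dim[of "x ` I" "x ` I"] eq assms(1) by (simp add: vec.span_superset)
  ultimately show ?thesis ..
qed

text \<open>Independence of the image as a set overlooks repeated members of the family. Together
  with injectivity it says that all linear relations indexed by \<open>I\<close> are
  trivial.\<close>

lemma independent_family_iff:
  fixes x :: "'i \<Rightarrow> 'a::field^'n"
  assumes "finite I"
  shows "inj_on x I \<and> vec.independent (x ` I) \<longleftrightarrow>
    (\<forall>c. (\<Sum>i\<in>I. c i *s x i) = 0 \<longrightarrow> (\<forall>i\<in>I. c i = 0))"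
    (is "?L \<longleftrightarrow> ?R")
proof
  assume L: ?L
  show ?R
  proof (intro allI impI ballI)
    fix c i assume *: "(\<Sum>i\<in>I. c i *s x i) = 0" "i \<in> I"
    have "(\<Sum>v\<in>x ` I. c (inv_into I x v) *s v) = (\<Sum>i\<in>I. c i *s x i)"
      using L by (subst sum.reindex) auto
    then have "c (inv_into I x (x i)) = 0"
      using L * assms by (intro vec.independentD[of "x ` I" "x ` I" "\<lambda>v. c (inv_into I x v)"]) auto
    then show "c i = 0" using L * by simp
  qed
next
  assume R: ?R
  have inj: "inj_on x I"
  proof (rule inj_onI, rule ccontr)
    fix i j assume ij: "i \<in> I" "j \<in> I" "x i = x j" "i \<noteq> j"
    \<comment> \<open>These are the coefficients of the difference of \<open>x i\<close> and
      \<open>x j\<close>, a nontrivial relation as soon as the indices differ.\<close>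
    let ?c = "\<lambda>k. (if k = i then 1 else 0 :: 'a) - (if k = j then 1 else 0)"
    have "(\<Sum>k\<in>I. ?c k *s x k) =
      (\<Sum>k\<in>I. if k = i then x k else 0) - (\<Sum>k\<in>I. if k = j then x k else 0)"
      by (subst sum_subtractf[symmetric]) (rule sum.cong, auto)
    also have "\<dots> = 0" using ij assms by simp
    finally have "?c i = 0" using R[rule_format, of ?c i] ij by blast
    then show False using ij by simp
  qed
  moreover have "vec.independent (x ` I)"
  proof (rule vec.independent_if_scalars_zero)
    show "finite (x ` I)" using assms by simp
    fix f v assume *: "(\<Sum>v\<in>x ` I. f v *s v) = 0" "v \<in> x ` I"
    have "(\<Sum>i\<in>I. f (x i) *s x i) = 0" using * inj by (subst (asm) sum.reindex) auto
    then show "f v = 0" using R[rule_format, of "\<lambda>i. f (x i)"] * by auto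
  qed
  ultimately show ?L ..
qed

text \<open>Induction on the total size of the sets. If some \<open>S i\<close> has two elements,
  one of the two can be deleted without destroying the condition: index sets that violate it after
  either deletion would, by submodularity of the dimension, contradict the condition before the
  deletions. When all sets are singletons, the condition for \<open>I\<close> itself is
  independence.\<close>

lemma rado_finite:
  fixes S :: "'i \<Rightarrow> ('a::field^'n) set"
  assumes "finite I" "\<And>i. i \<in> I \<Longrightarrow> finite (S i)"
    and "\<And>J. J \<subseteq> I \<Longrightarrow> card J \<le> vec.dim (\<Union>i\<in>J. S i)"
  shows "\<exists>x. (\<forall>i\<in>I. x i \<in> S i) \<and> inj_on x I \<and> vec.independent (x ` I)"
  using assms(2,3)
proof (induction "\<Sum>i\<in>I. card (S i)" arbitrary: S rule: less_induct)
  case less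
  show ?case
  proof (cases "\<exists>i\<in>I. \<exists>a\<in>S i. \<exists>b\<in>S i. a \<noteq> b")
    case False
    have "\<exists>v. S i = {v}" if "i \<in> I" for i
    proof -
      have "S i \<noteq> {}" using less.prems(2)[of "{i}"] that by auto
      then show ?thesis using False that by blast
    qed
    then obtain x where x: "\<And>i. i \<in> I \<Longrightarrow> S i = {x i}" by metis
    then have "(\<Union>i\<in>I. S i) = x ` I" by auto
    then have "inj_on x I \<and> vec.independent (x ` I)"
      using less.prems(2)[of I] independent_family_if_dim[OF assms(1), of x] by simp
    then show ?thesis using x by (intro exI[of _ x]) simp
  next
    case True
    then obtain i a b where iab: "i \<in> I" "a \<in> S i" "b \<in> S i" "a \<noteq> b" by blast
    \<comment> \<open>Without a transversal for \<open>S\<close> there is none after the deletion of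
      \<open>d\<close>, so by induction some index set violates the condition. It contains
      \<open>i\<close>, since the other sets are unchanged; leaving \<open>i\<close> out lowers the
      cardinality by one and turns the strict inequality into this one.\<close>
    have shrink: "\<exists>J\<subseteq>I - {i}. vec.dim ((\<Union>j\<in>J. S j) \<union> (S i - {d})) \<le> card J"
      if none: "\<not> (\<exists>x. (\<forall>i\<in>I. x i \<in> S i) \<and> inj_on x I \<and> vec.independent (x ` I))"
        and d: "d \<in> S i" for d
    proof -
      let ?S = "S(i := S i - {d})"
      have "(\<Sum>j\<in>I. card (?S j)) < (\<Sum>j\<in>I. card (S j))"
      proof (rule sum_strict_mono_ex1[OF assms(1)])
        show "\<forall>j\<in>I. card (?S j) \<le> card (S j)"
          using less.prems(1) by (auto intro!: card_mono)
        show "\<exists>j\<in>I. card (?S j) < card (S j)"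
          using iab(1) card_Diff1_less[OF less.prems(1)[OF iab(1)] d] by (intro bexI[of _ i]) simp_all
      qed
      moreover have "\<And>j. j \<in> I \<Longrightarrow> finite (?S j)" using less.prems(1) by auto
      moreover have "\<not> (\<exists>x. (\<forall>j\<in>I. x j \<in> ?S j) \<and> inj_on x I \<and> vec.independent (x ` I))"
      proof
        assume "\<exists>x. (\<forall>j\<in>I. x j \<in> ?S j) \<and> inj_on x I \<and> vec.independent (x ` I)"
        then obtain x where x: "\<forall>j\<in>I. x j \<in> ?S j" "inj_on x I \<and> vec.independent (x ` I)" by blast
        have "x j \<in> S j" if "j \<in> I" for j using x(1) that by (cases "j = i") auto
        then show False using none x(2) by blast
      qed
      ultimately obtain J where J: "J \<subseteq> I" "\<not> card J \<le> vec.dim (\<Union>j\<in>J. ?S j)"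
        using less.hyps[of ?S] by blast
      have "i \<in> J"
      proof (rule ccontr)
        assume "i \<notin> J"
        then have "(\<Union>j\<in>J. ?S j) = (\<Union>j\<in>J. S j)" by auto
        then show False using J less.prems(2) by auto
      qed
      have "(\<Union>j\<in>J. ?S j) = (\<Union>j\<in>J - {i}. S j) \<union> (S i - {d})"
        using \<open>i \<in> J\<close> by auto
      moreover have "card J = Suc (card (J - {i}))"
        using \<open>i \<in> J\<close> J(1) assms(1) by (metis card.remove finite_subset)
      ultimately show ?thesis
        using J by (intro exI[of _ "J - {i}"]) auto
    qed
    show ?thesis
    proof (rule ccontr)
      assume none: "\<not> ?thesis"
      obtain J1 where J1: "J1 \<subseteq> I - {i}" "vec.dim ((\<Union>j\<in>J1. S j) \<union> (S i - {a})) \<le> card J1"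
        using shrink[OF none iab(2)] by blast
      obtain J2 where J2: "J2 \<subseteq> I - {i}" "vec.dim ((\<Union>j\<in>J2. S j) \<union> (S i - {b})) \<le> card J2"
        using shrink[OF none iab(3)] by blast
      have fin: "finite J1" "finite J2"
        using J1(1) J2(1) assms(1) by (meson finite_Diff finite_subset)+
      let ?X = "(\<Union>j\<in>J1. S j) \<union> (S i - {a})" and ?Y = "(\<Union>j\<in>J2. S j) \<union> (S i - {b})"
      \<comment> \<open>As \<open>a\<close> and \<open>b\<close> differ, the union of
        \<open>?X\<close> and \<open>?Y\<close> contains all of \<open>S i\<close>. The condition
        for \<open>insert i (J1 \<union> J2)\<close> and for \<open>J1 \<inter> J2\<close> makes the
        left side at least \<open>card J1 + card J2 + 1\<close>, while the right side is at most
        \<open>card J1 + card J2\<close>.\<close>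
      have "vec.dim (?X \<union> ?Y) + vec.dim (\<Union>j\<in>J1 \<inter> J2. S j) \<le> vec.dim ?X + vec.dim ?Y"
        by (rule dim_Un_submodular) (auto intro!: vec.span_base)
      moreover have "vec.dim (?X \<union> ?Y) = vec.dim (\<Union>j\<in>insert i (J1 \<union> J2). S j)"
        using iab(4) by (intro arg_cong[where f = vec.dim]) auto
      moreover have "card (insert i (J1 \<union> J2)) \<le> vec.dim (\<Union>j\<in>insert i (J1 \<union> J2). S j)"
        using J1(1) J2(1) iab(1) by (intro less.prems(2)) auto
      moreover have "card (insert i (J1 \<union> J2)) = Suc (card (J1 \<union> J2))"
        using fin J1(1) J2(1) by (intro card_insert_disjoint) auto
      moreover have "card (J1 \<inter> J2) \<le> vec.dim (\<Union>j\<in>J1 \<inter> J2. S j)"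
        using J1(1) by (intro less.prems(2)) auto
      moreover have "card (J1 \<union> J2) + card (J1 \<inter> J2) = card J1 + card J2"
        using card_Un_Int[OF fin] by simp
      ultimately show False using J1(2) J2(2) by linarith
    qed
  qed
qed

text \<open>The condition only sees spans, so each possibly infinite set may be replaced by a finite
  subset that spans it. The sets used later, such as subspaces, are infinite.\<close>

lemma rado:
  fixes S :: "'i \<Rightarrow> ('a::field^'n) set"
  assumes "finite I" "\<And>J. J \<subseteq> I \<Longrightarrow> card J \<le> vec.dim (\<Union>i\<in>J. S i)"
  shows "\<exists>x. (\<forall>i\<in>I. x i \<in> S i) \<and> inj_on x I \<and> vec.independent (x ` I)"
proof -
  have "\<exists>B. B \<subseteq> S i \<and> finite B \<and> S i \<subseteq> vec.span B" for i
  proof -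
    obtain B where "B \<subseteq> S i" "vec.independent B" "S i \<subseteq> vec.span B"
      by (rule vec.maximal_independent_subset)
    then show ?thesis using vec.finiteI_independent by blast
  qed
  then have "\<forall>i. \<exists>B. B \<subseteq> S i \<and> finite B \<and> S i \<subseteq> vec.span B" ..
  from choice[OF this] obtain B where B: "\<And>i. B i \<subseteq> S i" "\<And>i. finite (B i)" "\<And>i. S i \<subseteq> vec.span (B i)"
    by auto
  have "\<exists>x. (\<forall>i\<in>I. x i \<in> B i) \<and> inj_on x I \<and> vec.independent (x ` I)"
  proof (rule rado_finite[OF assms(1)])
    fix J assume "J \<subseteq> I"
    have "(\<Union>i\<in>J. S i) \<subseteq> vec.span (\<Union>i\<in>J. B i)"
    proof
      fix y assume "y \<in> (\<Union>i\<in>J. S i)"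
      then obtain i where i: "i \<in> J" "y \<in> vec.span (B i)" using B(3) by auto
      moreover have "B i \<subseteq> (\<Union>i\<in>J. B i)" using i(1) by auto
      ultimately show "y \<in> vec.span (\<Union>i\<in>J. B i)" using vec.span_mono by auto
    qed
    then have "vec.dim (\<Union>i\<in>J. S i) \<le> vec.dim (\<Union>i\<in>J. B i)"
      by (rule vec.dim_mono)
    then show "card J \<le> vec.dim (\<Union>i\<in>J. B i)"
      using assms(2)[OF \<open>J \<subseteq> I\<close>] by linarith
  qed (use B in auto)
  then show ?thesis using B(1) by blast
qed

section \<open>Full row rank\<close>

lemma right_inverse_if_full_row_rank:
  fixes M :: "'a::field^'c^'r"
  assumes "rank M = CARD('r)"
  shows "\<exists>Q. M ** Q = mat 1"
proof -
  have "rows M = range (\<lambda>i. row i M)" by (auto simp: rows_def)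
  then have "inj (\<lambda>i. row i M) \<and> vec.independent (range (\<lambda>i. row i M))"
    using assms by (intro independent_family_if_dim) (auto simp: row_rank_def_gen)
  then show ?thesis
    unfolding matrix_right_invertible_independent_rows
    using independent_family_iff[of UNIV "\<lambda>i. row i M"] by auto
qed

lemma rank_le_rows:
  fixes M :: "'a::field^'c^'r"
  shows "rank M \<le> CARD('r)"
proof -
  have "rows M = range (\<lambda>i. row i M)" by (auto simp: rows_def)
  then have "rank M \<le> card (range (\<lambda>i. row i M))"
    unfolding row_rank_def_gen by (intro vec.dim_le_card) (simp_all add: vec.span_superset)
  also have "\<dots> \<le> CARD('r)" by (rule card_image_le) simp
  finally show ?thesis .
qed

section \<open>Polynomial kernel vectors of the pencil\<close>

lemma eval_mat_nth: "eval_mat M s $ i $ j = poly (M $ i $ j) s"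
  by (simp add: eval_mat_def)

lemma poly_det: "poly (det M) s = det (eval_mat M s)"
  by (simp add: det_def poly_sum poly_prod eval_mat_nth)

lemma matrix_add_vector_mult: "(M + N) *v x = M *v x + N *v (x :: 'a::comm_semiring_1^'n)"
  by (simp add: vec_eq_iff matrix_vector_mult_def sum.distrib algebra_simps)

text \<open>If \<open>Q\<close> is a right inverse of \<open>M(s)\<close>, then \<open>M(t) = M(s) N(t)\<close> for
  \<open>N(t) = I + Q (M(t) - M(s))\<close>, so \<open>adj (N(t)) x\<close> is a polynomial kernel vector of \<open>M\<close>.\<close>

lemma polynomial_kernel_vector:
  fixes M :: "complex poly^'c^'r"
  assumes rank: "rank (eval_mat M s) = CARD('r)" and ker: "eval_mat M s *v x = 0"
  obtains X :: "complex poly^'c" and Z :: "complex set" where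
    "\<And>k. poly (X $ k) s = x $ k" "finite Z"
    "\<And>t. t \<notin> Z \<Longrightarrow> eval_mat M t *v (\<chi> k. poly (X $ k) t) = 0"
proof -
  obtain Q where Q: "eval_mat M s ** Q = mat 1"
    using right_inverse_if_full_row_rank[OF rank] by blast
  define N :: "complex poly^'c^'c" where
    "N = (\<chi> i j. (if i = j then 1 else 0) + (\<Sum>r\<in>UNIV. [:Q $ i $ r:] * (M $ r $ j - [:poly (M $ r $ j) s:])))"
  have N: "eval_mat N t = mat 1 + Q ** (eval_mat M t - eval_mat M s)" for t
    by (simp add: vec_eq_iff eval_mat_nth N_def mat_def poly_sum matrix_matrix_mult_def)
  have Ns: "eval_mat N s = mat 1"
    by (simp add: N vec_eq_iff matrix_matrix_mult_def)
  have MN: "eval_mat M s *v (eval_mat N t *v y) = eval_mat M t *v y" for t y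
  proof -
    have "eval_mat M s *v (Q *v u) = u" for u
      by (simp add: matrix_vector_mul_assoc Q)
    then show ?thesis
      by (simp add: N matrix_add_vector_mult matrix_vector_right_distrib matrix_vector_mult_diff_rdistrib
          matrix_vector_mul_assoc[symmetric])
  qed
  \<comment> \<open>By Cramer's rule these determinants are the numerators of the solution of
    \<open>N(t) y = x\<close>, hence the entries of the adjugate applied to
    \<open>x\<close>.\<close>
  define X :: "complex poly^'c" where
    "X = (\<chi> k. det (\<chi> i j. if j = k then [:x $ i:] else N $ i $ j))"
  have Xt: "poly (X $ k) t = y $ k * det (eval_mat N t)" if "eval_mat N t *v y = x" for k t y
  proof -
    have "eval_mat (\<chi> i j. if j = k then [:x $ i:] else N $ i $ j) t
      = (\<chi> i j. if j = k then (eval_mat N t *v y) $ i else eval_mat N t $ i $ j)"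
      by (simp add: vec_eq_iff eval_mat_nth that)
    then show ?thesis by (simp add: X_def poly_det cramer_lemma)
  qed
  show thesis
  proof
    show "poly (X $ k) s = x $ k" for k
      using Xt[of s x k] by (simp add: Ns)
    have "poly (det N) s = 1" by (simp add: poly_det Ns)
    then have "det N \<noteq> 0" by auto
    \<comment> \<open>The exceptional set consists of the points where \<open>N(t)\<close> is
      singular. A finite set does no harm, because the kernel vector is only evaluated along
      infinitely many points.\<close>
    then show "finite {t. poly (det N) t = 0}" by (rule poly_roots_finite)
    fix t assume "t \<notin> {t. poly (det N) t = 0}"
    then have "invertible (eval_mat N t)" by (simp add: poly_det invertible_det_nz)
    then obtain N' where "eval_mat N t ** N' = mat 1" unfolding invertible_def by blast
    then have y: "eval_mat N t *v (N' *v x) = x" by (simp add: matrix_vector_mul_assoc)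
    have "(\<chi> k. poly (X $ k) t) = det (eval_mat N t) *s (N' *v x)"
      by (simp add: vec_eq_iff Xt[OF y])
    then have "eval_mat M t *v (\<chi> k. poly (X $ k) t) = det (eval_mat N t) *s (eval_mat M t *v (N' *v x))"
      by (simp add: vec.scale)
    also have "eval_mat M t *v (N' *v x) = eval_mat M s *v x"
      using MN[of t "N' *v x"] by (simp add: y)
    finally show "eval_mat M t *v (\<chi> k. poly (X $ k) t) = 0" by (simp add: ker)
  qed
qed

text \<open>A linear map that kills a basis of the span of \<open>W\<close> and fixes
  \<open>v\<close> is given by a matrix. The row at an index where \<open>v\<close> has a nonzero
  entry supplies the coefficients.\<close>

lemma separating_functional:
  fixes v :: "'a::field^'n"
  assumes "v \<notin> vec.span W"
  obtains c where "\<And>u. u \<in> W \<Longrightarrow> (\<Sum>k\<in>UNIV. c k * u $ k) = 0" "(\<Sum>k\<in>UNIV. c k * v $ k) \<noteq> 0"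
proof -
  obtain B where B: "B \<subseteq> W" "vec.independent B" "W \<subseteq> vec.span B"
    by (rule vec.maximal_independent_subset)
  have vB: "v \<notin> vec.span B" using assms B(1) vec.span_mono by blast
  then have ind: "vec.independent (insert v B)" using B(2) by (rule vec.independent_insertI)
  obtain g where g: "Vector_Spaces.linear (*s) (*s) g" "\<forall>u\<in>insert v B. g u = (if u = v then v else 0)"
    using vec.linear_independent_extend[OF ind, of "\<lambda>u. if u = v then v else 0"] by blast
  have v: "v \<notin> B" "v \<noteq> 0" using vB vec.span_base vec.span_zero by auto
  have gM: "g u = matrix g *v u" for u using matrix_works[OF g(1)] by simp
  have gB: "g u = 0" if "u \<in> W" for u
  proof (rule vec.linear_eq_0_on_span[OF g(1)])
    show "u \<in> vec.span B" using that B(3) by blast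
    show "g b = 0" if "b \<in> B" for b using that g(2) v(1) by auto
  qed
  from v(2) obtain i where "v $ i \<noteq> 0" by (auto simp: vec_eq_iff)
  moreover have "g v = v" using g(2) by simp
  ultimately have "(\<Sum>k\<in>UNIV. matrix g $ i $ k * v $ k) \<noteq> 0"
    using gM[of v] by (simp add: matrix_vector_mult_def vec_eq_iff)
  moreover have "(\<Sum>k\<in>UNIV. matrix g $ i $ k * u $ k) = 0" if "u \<in> W" for u
    using gM[of u] gB[OF that] by (simp add: matrix_vector_mult_def vec_eq_iff)
  ultimately show thesis using that by blast
qed

section \<open>The pencil in block form and its kernel\<close>

definition vjoin :: "'a^'n \<Rightarrow> 'a^'m \<Rightarrow> 'a^('n + 'm)" where
  "vjoin v w = (\<chi> k. case k of Inl i \<Rightarrow> v $ i | Inr j \<Rightarrow> w $ j)"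

lemma vjoin_nth [simp]: "vjoin v w $ Inl i = v $ i" "vjoin v w $ Inr j = w $ j"
  by (simp_all add: vjoin_def)

lemma vjoin_eq_iff: "vjoin v w = vjoin v' w' \<longleftrightarrow> v = v' \<and> w = w'"
  by (metis vec_eq_iff vjoin_nth)

lemma vjoin_split: "\<exists>v w. x = vjoin v w"
  by (rule exI[of _ "\<chi> i. x $ Inl i"], rule exI[of _ "\<chi> j. x $ Inr j"])
    (simp add: vec_eq_iff vjoin_def split: sum.split)

lemma vjoin_eq_0_iff: "vjoin v w = 0 \<longleftrightarrow> v = 0 \<and> w = 0"
  using vjoin_eq_iff[of v w 0 0] by (auto simp: vec_eq_iff vjoin_def split: sum.splits)

lemma mat_vector_mult: "mat s *v v = s *s (v :: 'a::semiring_1^'n)"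
proof -
  have "(if i = j then s else 0) * v $ j = (if i = j then s * v $ j else 0)" for i j by simp
  then show ?thesis by (simp add: vec_eq_iff matrix_vector_mult_def mat_def)
qed

lemma sum_UNIV_Plus: "(\<Sum>k\<in>UNIV. f k) = (\<Sum>i\<in>UNIV. f (Inl i)) + (\<Sum>j\<in>UNIV. f (Inr j))"
  for f :: "'a::finite + 'b::finite \<Rightarrow> 'c::comm_monoid_add"
  by (subst UNIV_Plus_UNIV[symmetric], subst sum.Plus) simp_all

lemma eval_system_pencil:
  "eval_mat (system_pencil A B C D) s *v vjoin v w =
    vjoin ((cmat A - mat s) *v v + cmat B *v w) (cmat C *v v + cmat D *v w)"
proof -
  have "(eval_mat (system_pencil A B C D) s *v vjoin v w) $ Inl i =
    ((cmat A - mat s) *v v + cmat B *v w) $ i" for i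
    unfolding matrix_vector_mult_def vector_add_component vec_lambda_beta sum_UNIV_Plus vjoin_nth
    by (intro arg_cong2[where f = "(+)"] sum.cong) (simp_all add: eval_mat_nth system_pencil_def mat_def)
  moreover have "(eval_mat (system_pencil A B C D) s *v vjoin v w) $ Inr l =
    (cmat C *v v + cmat D *v w) $ l" for l
    unfolding matrix_vector_mult_def vector_add_component vec_lambda_beta sum_UNIV_Plus vjoin_nth
    by (intro arg_cong2[where f = "(+)"] sum.cong) (simp_all add: eval_mat_nth system_pencil_def)
  ultimately show ?thesis
    by (simp add: vec_eq_iff vjoin_def split: sum.split)
qed

lemma \<R>_iff: "v \<in> \<R> A B C D s \<longleftrightarrow>
    (\<exists>w. eval_mat (system_pencil A B C D) s *v vjoin v w = 0)"
  by (simp add: \<R>_def eval_system_pencil vjoin_eq_0_iff)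

text \<open>Otherwise a linear functional kills the spaces at all points of \<open>S\<close> but not
  \<open>v\<close>. Applied to the state part of the polynomial kernel vector through
  \<open>v\<close>, it gives a polynomial with infinitely many roots that does not vanish at
  \<open>s\<close>.\<close>

lemma \<R>_subset_span_\<R>:
  fixes A :: "real^'n^'n" and B :: "real^'m^'n" and C :: "real^'n^'p" and D :: "real^'m^'p"
  assumes "rank (eval_mat (system_pencil A B C D) s) = CARD('n + 'p)" "infinite S"
  shows "\<R> A B C D s \<subseteq> vec.span (\<Union>t\<in>S. \<R> A B C D t)"
proof (rule subsetI, rule ccontr)
  fix v assume v: "v \<in> \<R> A B C D s" "v \<notin> vec.span (\<Union>t\<in>S. \<R> A B C D t)"
  obtain w where w: "eval_mat (system_pencil A B C D) s *v vjoin v w = 0"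
    using v(1) \<R>_iff by blast
  obtain X Z where X: "\<And>k. poly (X $ k) s = vjoin v w $ k" "finite Z"
    "\<And>t. t \<notin> Z \<Longrightarrow> eval_mat (system_pencil A B C D) t *v (\<chi> k. poly (X $ k) t) = 0"
    using polynomial_kernel_vector[OF assms(1) w] by blast
  obtain c where c: "\<And>u. u \<in> (\<Union>t\<in>S. \<R> A B C D t) \<Longrightarrow> (\<Sum>k\<in>UNIV. c k * u $ k) = 0"
      "(\<Sum>k\<in>UNIV. c k * v $ k) \<noteq> 0"
    using separating_functional[OF v(2)] by blast
  let ?q = "\<Sum>k\<in>UNIV. smult (c k) (X $ Inl k)"
  have q: "poly ?q t = (\<Sum>k\<in>UNIV. c k * poly (X $ Inl k) t)" for t
    by (simp add: poly_sum)
  have "poly ?q t = 0" if "t \<in> S - Z" for t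
  proof -
    have "(\<chi> k. poly (X $ k) t) = vjoin (\<chi> k. poly (X $ Inl k) t) (\<chi> k. poly (X $ Inr k) t)"
      by (simp add: vec_eq_iff vjoin_def split: sum.split)
    then have "(\<chi> k. poly (X $ Inl k) t) \<in> \<R> A B C D t"
      using X(3)[of t] that unfolding \<R>_iff by auto
    then show ?thesis using c(1)[of "\<chi> k. poly (X $ Inl k) t"] that by (auto simp: q)
  qed
  then have "S - Z \<subseteq> {t. poly ?q t = 0}" by blast
  moreover have "infinite (S - Z)" using assms(2) X(2) by simp
  ultimately have "?q = 0" using poly_roots_finite finite_subset by blast
  then have "poly ?q s = 0" by simp
  then show False using c(2) by (simp add: q X(1))
qed

text \<open>Right invertibility gives full row rank off a finite set, thus at some point, so the
  normal rank is full. At a number that is not a zero the rank is no smaller than the normal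
  rank.\<close>

lemma full_row_rank_if_not_invariant_zero:
  fixes A :: "real^'n^'n" and B :: "real^'m^'n" and C :: "real^'n^'p" and D :: "real^'m^'p"
  assumes "right_invertible A B C D" "s \<notin> invariant_zeros A B C D"
  shows "rank (eval_mat (system_pencil A B C D) s) = CARD('n + 'p)"
proof -
  let ?r = "\<lambda>s. rank (eval_mat (system_pencil A B C D) s)"
  have "infinite (UNIV - {s. ?r s \<noteq> CARD('n) + CARD('p)})"
    using assms(1) infinite_UNIV_char_0 unfolding right_invertible_def by auto
  then have "UNIV - {s. ?r s \<noteq> CARD('n) + CARD('p)} \<noteq> {}" by (metis finite.emptyI)
  then obtain t where t: "?r t = CARD('n + 'p)" by auto
  \<comment> \<open>\<open>Max\<close> is only meaningful for a finite set, so the ranks have to be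
    bounded before it can be compared with one of them.\<close>
  have "range ?r \<subseteq> {..CARD('n + 'p)}"
    using rank_le_rows[of "eval_mat (system_pencil A B C D) _"] by blast
  then have "finite (range ?r)" by (rule finite_subset) simp
  then have "?r t \<le> normal_rank (system_pencil A B C D)"
    unfolding normal_rank_def by (rule Max_ge) simp
  then have "CARD('n + 'p) \<le> ?r s" using assms(2) t by (simp add: invariant_zeros_def)
  then show ?thesis using rank_le_rows[of "eval_mat (system_pencil A B C D) s"] by simp
qed

section \<open>Real and conjugate kernel vectors\<close>

lemma cnj_vec_nth [simp]: "cnj_vec v $ k = cnj (v $ k)"
  by (simp add: cnj_vec_def)

lemma cnj_vec_cnj_vec [simp]: "cnj_vec (cnj_vec v) = v"
  by (simp add: vec_eq_iff)

lemma cnj_vec_add: "cnj_vec (u + v) = cnj_vec u + cnj_vec v"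
  by (simp add: vec_eq_iff)

lemma cnj_vec_scale: "cnj_vec (a *s v) = cnj a *s cnj_vec v"
  by (simp add: vec_eq_iff)

lemma cnj_vec_0 [simp]: "cnj_vec 0 = 0"
  by (simp add: vec_eq_iff)

lemma cnj_vec_axis [simp]: "cnj_vec (axis i 1) = axis i 1"
  by (simp add: vec_eq_iff axis_def)

lemma cnj_vec_cmat_mult: "cnj_vec (cmat M *v v) = cmat M *v cnj_vec v"
  by (simp add: vec_eq_iff matrix_vector_mult_def)

lemma cnj_vec_eq_iff: "cnj_vec u = cnj_vec v \<longleftrightarrow> u = v"
  by (metis cnj_vec_cnj_vec)

text \<open>The output \<open>y\<close> is left free so that the cases \<open>y = 0\<close> of
  \<open>\<R>\<close> and \<open>y = \<delta> e_i\<close> of \<open>R_hat\<close> share the same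
  closure properties. The first equation has the shape of the eigenvector equation of the closed
  loop with \<open>w = F v\<close>.\<close>

definition solves_pencil ::
  "real^'n^'n \<Rightarrow> real^'m^'n \<Rightarrow> real^'n^'p \<Rightarrow> real^'m^'p \<Rightarrow>
   complex \<Rightarrow> complex^'n \<Rightarrow> complex^'m \<Rightarrow> complex^'p \<Rightarrow> bool" where
  "solves_pencil A B C D s v w y \<longleftrightarrow>
     cmat A *v v + cmat B *v w = s *s v \<and> cmat C *v v + cmat D *v w = y"

lemma pencil_eq_iff:
  fixes A :: "real^'n^'n"
  shows
  "(cmat A - mat s) *v v + cmat B *v w = 0 \<longleftrightarrow> cmat A *v v + cmat B *v w = s *s v"
proof -
  have "x - y + z = 0 \<longleftrightarrow> x + z = y" for x y z :: "complex^'n"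
    by (simp add: diff_add_eq)
  then show ?thesis by (simp add: matrix_vector_mult_diff_rdistrib mat_vector_mult)
qed

lemma \<R>_iff_solves: "v \<in> \<R> A B C D s \<longleftrightarrow> (\<exists>w. solves_pencil A B C D s v w 0)"
  by (simp add: \<R>_def solves_pencil_def pencil_eq_iff)

lemma R_hat_iff_solves:
  "v \<in> R_hat A B C D i s \<longleftrightarrow>
    (\<exists>w \<delta>. \<delta> \<noteq> 0 \<and> solves_pencil A B C D s v w (complex_of_real \<delta> *s axis i 1))"
  by (simp add: R_hat_def solves_pencil_def pencil_eq_iff)

lemma matrix_pair_add:
  "M *v (v + v') + N *v (w + w') = (M *v v + N *v w) + (M *v v' + N *v w')"
  for M :: "'a::comm_ring_1^'n^'p" and N :: "'a^'m^'p"
  by (simp add: matrix_vector_right_distrib)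

lemma matrix_pair_scale: "M *v (a *s v) + N *v (a *s w) = a *s (M *v v + N *v w)"
  for M :: "'a::field^'n^'p" and N :: "'a^'m^'p"
  by (simp add: vec.scale vec.scale_right_distrib)

lemma matrix_pair_cnj:
  "cmat M *v cnj_vec v + cmat N *v cnj_vec w = cnj_vec (cmat M *v v + cmat N *v w)"
  by (simp add: cnj_vec_add cnj_vec_cmat_mult)

lemma solves_pencil_add:
  "solves_pencil A B C D s v w y \<Longrightarrow> solves_pencil A B C D s v' w' y' \<Longrightarrow>
    solves_pencil A B C D s (v + v') (w + w') (y + y')"
  unfolding solves_pencil_def matrix_pair_add by (simp add: vec.scale_right_distrib)

lemma solves_pencil_scale:
  "solves_pencil A B C D s v w y \<Longrightarrow> solves_pencil A B C D s (a *s v) (a *s w) (a *s y)"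
  unfolding solves_pencil_def matrix_pair_scale by (simp add: mult.commute)

lemma solves_pencil_cnj:
  "solves_pencil A B C D s v w y \<Longrightarrow>
    solves_pencil A B C D (cnj s) (cnj_vec v) (cnj_vec w) (cnj_vec y)"
  unfolding solves_pencil_def matrix_pair_cnj by (simp add: cnj_vec_scale)

lemma subspace_\<R>: "vec.subspace (\<R> A B C D s)"
proof (rule vec.subspaceI)
  show "0 \<in> \<R> A B C D s" by (auto simp: \<R>_iff_solves solves_pencil_def intro!: exI[of _ 0])
  show "x + y \<in> \<R> A B C D s" if "x \<in> \<R> A B C D s" "y \<in> \<R> A B C D s" for x y
    using that solves_pencil_add[of A B C D s x _ 0 y _ 0] by (auto simp: \<R>_iff_solves)
  show "c *s x \<in> \<R> A B C D s" if "x \<in> \<R> A B C D s" for c x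
    using that solves_pencil_scale[of A B C D s x _ 0 c] by (auto simp: \<R>_iff_solves)
qed

lemma cnj_vec_\<R>: "v \<in> \<R> A B C D s \<Longrightarrow> cnj_vec v \<in> \<R> A B C D (cnj s)"
  using solves_pencil_cnj[of A B C D s v _ 0] by (auto simp: \<R>_iff_solves)

text \<open>The real part stays in the complex space and is written as a combination of the vector
  and its conjugate, so that linearity of the pencil applies to it directly.\<close>

definition Re_vec :: "complex^'n \<Rightarrow> complex^'n" where
  "Re_vec v = (1/2) *s (v + cnj_vec v)"

definition Im_vec :: "complex^'n \<Rightarrow> complex^'n" where
  "Im_vec v = (- \<i>/2) *s (v - cnj_vec v)"

lemma cnj_vec_Re_vec [simp]: "cnj_vec (Re_vec v) = Re_vec v"
  by (simp add: Re_vec_def vec_eq_iff)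

lemma cnj_vec_Im_vec [simp]: "cnj_vec (Im_vec v) = Im_vec v"
  by (simp add: Im_vec_def vec_eq_iff algebra_simps)

lemma Re_vec_Im_vec: "v = Re_vec v + \<i> *s Im_vec v"
  by (simp add: Re_vec_def Im_vec_def vec_eq_iff algebra_simps)

text \<open>For real \<open>s\<close> the conjugate of a solution solves the pencil at the same
  point, so the combination of both is again a solution.\<close>

lemma solves_pencil_Re_vec:
  assumes "s \<in> \<real>" "solves_pencil A B C D s v w y"
  shows "solves_pencil A B C D s (Re_vec v) (Re_vec w) (Re_vec y)"
  unfolding Re_vec_def
  using assms solves_pencil_cnj[OF assms(2)]
  by (intro solves_pencil_scale solves_pencil_add) (auto simp: Reals_cnj_iff)

lemma solves_pencil_Im_vec:
  assumes "s \<in> \<real>" "solves_pencil A B C D s v w y"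
  shows "solves_pencil A B C D s (Im_vec v) (Im_vec w) (Im_vec y)"
proof -
  have "solves_pencil A B C D s (v + (-1) *s cnj_vec v) (w + (-1) *s cnj_vec w) (y + (-1) *s cnj_vec y)"
    using assms solves_pencil_cnj[OF assms(2)]
    by (intro solves_pencil_scale solves_pencil_add) (auto simp: Reals_cnj_iff)
  then show ?thesis
    unfolding Im_vec_def by (intro solves_pencil_scale) simp
qed

lemma real_axis_Re_Im:
  "Re_vec (complex_of_real \<delta> *s axis i 1) = complex_of_real \<delta> *s axis i 1"
  "Im_vec (complex_of_real \<delta> *s axis i 1) = 0"
  by (simp_all add: Re_vec_def Im_vec_def vec_eq_iff axis_def)

lemma Re_Im_vec_0 [simp]: "Re_vec 0 = 0" "Im_vec 0 = 0"
  by (simp_all add: Re_vec_def Im_vec_def)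

lemma span_Re_Im_vec:
  assumes "Re_vec v \<in> vec.span W" "Im_vec v \<in> vec.span W"
  shows "v \<in> vec.span W"
  using assms by (subst Re_vec_Im_vec) (intro vec.span_add vec.span_scale)

lemma \<R>_subset_span_real:
  assumes "s \<in> \<real>"
  shows "\<R> A B C D s \<subseteq> vec.span {v \<in> \<R> A B C D s. cnj_vec v = v}"
proof
  fix v assume "v \<in> \<R> A B C D s"
  then obtain w where w: "solves_pencil A B C D s v w 0" by (auto simp: \<R>_iff_solves)
  have "Re_vec v \<in> \<R> A B C D s" "Im_vec v \<in> \<R> A B C D s"
    using solves_pencil_Re_vec[OF assms w] solves_pencil_Im_vec[OF assms w]
    by (auto simp: \<R>_iff_solves)
  then show "v \<in> vec.span {v \<in> \<R> A B C D s. cnj_vec v = v}"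
    by (intro span_Re_Im_vec[OF vec.span_base vec.span_base]) simp_all
qed

text \<open>Since \<delta> must not vanish, \<open>R_hat\<close> is not treated as a subspace: the
  imaginary part of \<open>v\<close> has output 0, which gives no membership. Adding it to the real
  part restores the output, and the difference of two real members then recovers it.\<close>

lemma R_hat_subset_span_real:
  assumes "s \<in> \<real>"
  shows "R_hat A B C D i s \<subseteq> vec.span {v \<in> R_hat A B C D i s. cnj_vec v = v}"
proof
  fix v assume "v \<in> R_hat A B C D i s"
  then obtain w \<delta> where w: "\<delta> \<noteq> 0" "solves_pencil A B C D s v w (complex_of_real \<delta> *s axis i 1)"
    by (auto simp: R_hat_iff_solves)
  have re: "solves_pencil A B C D s (Re_vec v) (Re_vec w) (complex_of_real \<delta> *s axis i 1)"
    using solves_pencil_Re_vec[OF assms w(2)] by (simp add: real_axis_Re_Im)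
  have "solves_pencil A B C D s (Im_vec v) (Im_vec w) 0"
    using solves_pencil_Im_vec[OF assms w(2)] by (simp add: real_axis_Re_Im)
  from solves_pencil_add[OF re this] re
  have "Re_vec v \<in> R_hat A B C D i s" "Re_vec v + Im_vec v \<in> R_hat A B C D i s"
    using w(1) by (auto simp: R_hat_iff_solves)
  then have re': "Re_vec v \<in> vec.span {v \<in> R_hat A B C D i s. cnj_vec v = v}"
    and "Re_vec v + Im_vec v \<in> vec.span {v \<in> R_hat A B C D i s. cnj_vec v = v}"
    by (auto intro!: vec.span_base simp: cnj_vec_add)
  from vec.span_diff[OF this(2) re'] show "v \<in> vec.span {v \<in> R_hat A B C D i s. cnj_vec v = v}"
    using span_Re_Im_vec[OF re'] by simp
qed

text \<open>A union over the eigenvalue and in general not a subspace. A vector chosen from it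
  brings along its own real stable eigenvalue, which may be a real zero.\<close>

definition real_unobservable ::
  "time_domain \<Rightarrow> real^'n^'n \<Rightarrow> real^'m^'n \<Rightarrow> real^'n^'p \<Rightarrow> real^'m^'p \<Rightarrow> (complex^'n) set" where
  "real_unobservable T A B C D =
     {v. cnj_vec v = v \<and> (\<exists>s \<in> stable_region T \<inter> \<real>. v \<in> \<R> A B C D s)}"

text \<open>A real number in the union is dealt with by real and imaginary parts. A nonreal one is
  not an invariant zero, as the nonreal stable zeros are excluded, so its kernel vectors can be
  moved to real points first.\<close>

lemma E_g_0_subset_span_real:
  fixes A :: "real^'n^'n" and B :: "real^'m^'n" and C :: "real^'n^'p" and D :: "real^'m^'p"
  assumes "right_invertible A B C D"
  shows "E_g T A B C D z 0 \<subseteq> vec.span (real_unobservable T A B C D)"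
proof -
  have real: "\<R> A B C D s \<subseteq> vec.span (real_unobservable T A B C D)"
    if "s \<in> stable_region T" "s \<in> \<real>" for s
  proof -
    have "{v \<in> \<R> A B C D s. cnj_vec v = v} \<subseteq> real_unobservable T A B C D"
      unfolding real_unobservable_def using that by blast
    from order_trans[OF \<R>_subset_span_real[OF that(2)] vec.span_mono[OF this]]
    show ?thesis .
  qed
  have "\<R> A B C D s \<subseteq> vec.span (real_unobservable T A B C D)"
    if s: "s \<in> stable_region T" "s \<notin> nonreal_minimum_phase_zeros T A B C D" for s
  proof (cases "s \<in> \<real>")
    case False
    then have "s \<notin> invariant_zeros A B C D"
      using s by (auto simp: nonreal_minimum_phase_zeros_def)
    then have rank: "rank (eval_mat (system_pencil A B C D) s) = CARD('n + 'p)"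
      using assms by (intro full_row_rank_if_not_invariant_zero)
    \<comment> \<open>This interval lies both in the open left half-plane and in the open unit disc,
      so one choice serves both time domains.\<close>
    let ?S = "complex_of_real ` {-1<..<0}"
    have "infinite ?S"
      by (subst finite_image_iff) (auto simp: inj_on_def infinite_Ioo)
    then have "\<R> A B C D s \<subseteq> vec.span (\<Union>t\<in>?S. \<R> A B C D t)"
      by (rule \<R>_subset_span_\<R>[OF rank])
    moreover have stable: "t \<in> stable_region T" if "t \<in> ?S" for t
      using that by (cases T) (auto simp: stable_region_def)
    have "(\<Union>t\<in>?S. \<R> A B C D t) \<subseteq> vec.span (real_unobservable T A B C D)"
    proof (rule UN_least)
      fix t assume t: "t \<in> ?S"
      then have "t \<in> \<real>" by auto
      with stable[OF t] show "\<R> A B C D t \<subseteq> vec.span (real_unobservable T A B C D)"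
        by (rule real)
    qed
    then have "vec.span (\<Union>t\<in>?S. \<R> A B C D t) \<subseteq> vec.span (real_unobservable T A B C D)"
      by (rule vec.span_minimal) (rule vec.subspace_span)
    ultimately show ?thesis by (rule order_trans)
  qed (rule real[OF s(1)])
  then show ?thesis by (auto simp: E_g_def)
qed

section \<open>Exchange of two basis vectors for a conjugate pair\<close>

lemma det_row_update_add:
  "det (\<chi> i. if i = a then u + v else X i) =
    det (\<chi> i. if i = a then u else X i) + det (\<chi> i. if i = a then v else X i)"
  for X :: "'n \<Rightarrow> 'a::comm_ring_1^'n"
  by (rule det_row_add)

lemma det_row_update_scale:
  "det (\<chi> i. if i = a then c *s u else X i) = c * det (\<chi> i. if i = a then u else X i)"
  for X :: "'n \<Rightarrow> 'a::comm_ring_1^'n"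
  by (rule det_row_mul)

lemma det_nz_iff_independent_rows:
  fixes X :: "'n \<Rightarrow> 'a::field^'n"
  shows "det (\<chi> i. X i) \<noteq> 0 \<longleftrightarrow> inj X \<and> vec.independent (range X)"
  unfolding invertible_det_nz[symmetric] invertible_right_inverse
    matrix_right_invertible_independent_rows independent_family_iff[of UNIV X, simplified]
  by (simp add: row_def)

text \<open>With all other rows fixed, the determinant is a sesquilinear form \<open>b u v\<close> in the row \<open>u\<close> and
  the conjugate of the row \<open>v\<close>, so by polarization \<open>b u u\<close> does not vanish identically.\<close>

lemma conjugate_pair_exchange:
  fixes X :: "'n \<Rightarrow> complex^'n"
  assumes "vec.subspace U" "inj X" "vec.independent (range X)" "a \<noteq> b"
    "X a \<in> U" "cnj_vec (X b) \<in> U"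
  obtains u where "u \<in> U" "inj (X(a := u, b := cnj_vec u))"
    "vec.independent (range (X(a := u, b := cnj_vec u)))"
proof -
  define d where "d u v = det (\<chi> i. (X(a := u, b := cnj_vec v)) i)" for u v
  have d: "d u v = det (\<chi> i. if i = a then u else (X(b := cnj_vec v)) i)"
    "d u v = det (\<chi> i. if i = b then cnj_vec v else (X(a := u)) i)" for u v
    using assms(4) unfolding d_def by (auto intro!: arg_cong[where f = det] simp: vec_eq_iff)
  have d_add: "d (u + u') v = d u v + d u' v" "d u (v + v') = d u v + d u v'" for u u' v v'
  proof -
    show "d (u + u') v = d u v + d u' v" by (simp only: d(1) det_row_update_add)
    show "d u (v + v') = d u v + d u v'" by (simp only: d(2) cnj_vec_add det_row_update_add)
  qed
  have d_scale: "d u (k *s v) = cnj k * d u v" "d (k *s u) v = k * d u v" for k u v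
  proof -
    show "d (k *s u) v = k * d u v" by (simp only: d(1) det_row_update_scale)
    show "d u (k *s v) = cnj k * d u v" by (simp only: d(2) cnj_vec_scale det_row_update_scale)
  qed
  define v where "v = cnj_vec (X b)"
  have "X(a := X a, b := cnj_vec v) = X" by (simp add: v_def)
  then have nz: "d (X a) v \<noteq> 0"
    using assms(2,3) det_nz_iff_independent_rows[of X] by (simp add: d_def)
  have "\<exists>u\<in>U. d u u \<noteq> 0"
  proof (rule ccontr)
    assume "\<not> ?thesis"
    then have 0: "d u u = 0" if "u \<in> U" for u using that by blast
    have U: "X a \<in> U" "v \<in> U" "X a + v \<in> U" "X a + \<i> *s v \<in> U"
      using assms(1,5,6) by (auto simp: v_def vec.subspace_def)
    have "d (X a) v + d v (X a) = 0"
      using 0[OF U(3)] 0[OF U(1)] 0[OF U(2)] by (simp add: d_add add.commute)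
    \<comment> \<open>Conjugate linearity in the second argument produces the opposite signs. For a
      bilinear form this relation would only repeat the previous one, and an alternating form would
      be left over.\<close>
    moreover have "- (\<i> * d (X a) v) + \<i> * d v (X a) = 0"
      using 0[OF U(4)] 0[OF U(1)] 0[OF U(2)] by (simp add: d_add d_scale add.commute)
    ultimately have "d (X a) v = 0"
      by (simp add: add_eq_0_iff)
    then show False using nz by simp
  qed
  then obtain u where "u \<in> U" "d u u \<noteq> 0" by blast
  then show thesis
    using that[of u] det_nz_iff_independent_rows[of "X(a := u, b := cnj_vec u)"] by (simp add: d_def)
qed

section \<open>Feedback from an eigenbasis\<close>

definition cvec :: "real^'n \<Rightarrow> complex^'n" where
  "cvec x = (\<chi> k. complex_of_real (x $ k))"

lemma cvec_nth [simp]: "cvec x $ k = complex_of_real (x $ k)"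
  by (simp add: cvec_def)

lemma cmat_mult_cvec: "cmat M *v cvec x = cvec (M *v x)"
  by (simp add: vec_eq_iff matrix_vector_mult_def)

lemma cmat_add: "cmat (M + N) = cmat M + cmat N"
  by (simp add: vec_eq_iff)

lemma cmat_mult: "cmat (M ** N) = cmat M ** cmat N"
  by (simp add: vec_eq_iff matrix_matrix_mult_def)

lemma cmat_feedback_mult:
  "cmat (M + N ** F) *v v = cmat M *v v + cmat N *v (cmat F *v v)"
  by (simp add: cmat_add cmat_mult matrix_add_vector_mult matrix_vector_mul_assoc)

text \<open>\<open>L\<close> is the inverse of the matrix whose columns are the \<open>X k\<close>;
  its rows form the dual basis.\<close>

lemma basis_coordinates:
  fixes X :: "'n \<Rightarrow> 'a::field^'n"
  assumes "inj X" "vec.independent (range X)"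
  obtains L where "\<And>k. L *v X k = axis k 1" "\<And>u. u = (\<Sum>k\<in>UNIV. (L *v u) $ k *s X k)"
proof -
  have "det (\<chi> k. X k) \<noteq> 0" using assms det_nz_iff_independent_rows[of X] by simp
  then have "invertible (transpose (\<chi> k. X k))"
    by (simp add: invertible_det_nz det_transpose)
  then obtain L where L: "transpose (\<chi> k. X k) ** L = mat 1" "L ** transpose (\<chi> k. X k) = mat 1"
    unfolding invertible_def by blast
  have X: "transpose (\<chi> k. X k) *v y = (\<Sum>k\<in>UNIV. y $ k *s X k)" for y
    by (simp add: vec_eq_iff matrix_vector_mult_def transpose_def mult.commute)
  have "transpose (\<chi> k. X k) *v axis k 1 = X k" for k
    by (simp add: vec_eq_iff matrix_vector_mult_def transpose_def axis_def if_distrib cong: if_cong)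
  then have "L *v X k = axis k 1" for k
    by (metis L(2) matrix_vector_mul_assoc matrix_vector_mul_lid)
  moreover have "u = (\<Sum>k\<in>UNIV. (L *v u) $ k *s X k)" for u
    unfolding X[symmetric] by (simp add: matrix_vector_mul_assoc L(1))
  ultimately show thesis using that by blast
qed

lemma mult_family:
  fixes M :: "'a::field^'n^'m"
  shows "M *v (\<Sum>k\<in>K. c k *s X k) = (\<Sum>k\<in>K. c k *s (M *v X k))"
  by (simp add: vec.sum vec.scale)

text \<open>Exactly one complex matrix maps each \<open>X k\<close> to \<open>W k\<close>.
  Conjugation moves both families by the same index map, so the entrywise conjugate has this
  property too. The matrix therefore equals its conjugate and is real.\<close>

lemma real_matrix_of_conjugate_family:
  fixes X :: "'n \<Rightarrow> complex^'n" and W :: "'n \<Rightarrow> complex^'m"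
  assumes "inj X" "vec.independent (range X)"
    and "\<And>k. cnj_vec (X k) = X (\<pi> k)" "\<And>k. cnj_vec (W k) = W (\<pi> k)"
  shows "\<exists>F :: real^'n^'m. \<forall>k. cmat F *v X k = W k"
proof -
  obtain L where L: "\<And>k. L *v X k = axis k 1" "\<And>u. u = (\<Sum>k\<in>UNIV. (L *v u) $ k *s X k)"
    using basis_coordinates[OF assms(1,2)] by blast
  define U :: "complex^'n^'m" where "U = (\<chi> i k. W k $ i) ** L"
  have U: "U *v X k = W k" for k
    unfolding U_def matrix_vector_mul_assoc[symmetric] L(1)
    by (simp add: vec_eq_iff matrix_vector_mult_def axis_def if_distrib cong: if_cong)
  define U' where "U' = map_matrix cnj U"
  have "U' *v X k = W k" for k
  proof -
    have "U' *v X k = cnj_vec (U *v cnj_vec (X k))"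
      by (simp add: vec_eq_iff matrix_vector_mult_def U'_def)
    also have "\<dots> = W k" by (simp add: assms(3) U assms(4)[symmetric])
    finally show ?thesis .
  qed
  then have "U' *v u = U *v u" for u
    using U by (subst (1 2) L(2)[of u]) (simp only: mult_family)
  then have "U' = U" by (simp add: matrix_eq)
  then have real: "cnj (U $ i $ j) = U $ i $ j" for i j
    by (metis U'_def nth_map_matrix)
  have "cmat (map_matrix Re U) = U"
    using real by (simp add: vec_eq_iff complex_eq_iff)
  then show ?thesis using U by (intro exI[of _ "map_matrix Re U"]) simp
qed

text \<open>In the dual coordinates the matrix is diagonal. This reduces the location of the
  spectrum, the differential equation and the recursion to scalar statements.\<close>

lemma eigenbasis_coordinates:
  fixes M :: "real^'n^'n" and X :: "'n \<Rightarrow> complex^'n"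
  assumes X: "inj X" "vec.independent (range X)" "\<And>k. cmat M *v X k = e k *s X k"
    and L: "\<And>k. L *v X k = axis k 1" "\<And>u. u = (\<Sum>k\<in>UNIV. (L *v u) $ k *s X k)"
  shows "(L *v (cmat M *v u)) $ k = e k * (L *v u) $ k"
proof -
  have "cmat M *v u = (\<Sum>j\<in>UNIV. (L *v u) $ j *s (e j *s X j))"
    by (subst L(2)[of u]) (simp only: mult_family X(3))
  also have "\<dots> = (\<Sum>j\<in>UNIV. (e j * (L *v u) $ j) *s X j)"
    by (simp add: mult.commute)
  finally have "L *v (cmat M *v u) = (\<Sum>j\<in>UNIV. (e j * (L *v u) $ j) *s axis j 1)"
    by (simp only: mult_family L(1))
  then have "(L *v (cmat M *v u)) $ k = (\<Sum>j\<in>UNIV. if j = k then e j * (L *v u) $ j else 0)"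
    by (simp add: axis_def if_distrib cong: if_cong)
  then show ?thesis by simp
qed

lemma eigenvalues_subset_eigenbasis:
  fixes M :: "real^'n^'n" and X :: "'n \<Rightarrow> complex^'n"
  assumes X: "inj X" "vec.independent (range X)" "\<And>k. cmat M *v X k = e k *s X k"
  shows "eigenvalues M \<subseteq> range e"
proof
  fix s assume "s \<in> eigenvalues M"
  then obtain v where v: "v \<noteq> 0" "cmat M *v v = s *s v" by (auto simp: eigenvalues_def)
  obtain L where L: "\<And>k. L *v X k = axis k 1" "\<And>u. u = (\<Sum>k\<in>UNIV. (L *v u) $ k *s X k)"
    using basis_coordinates[OF X(1,2)] by blast
  have "\<exists>k. (L *v v) $ k \<noteq> 0"
  proof (rule ccontr)
    assume "\<nexists>k. (L *v v) $ k \<noteq> 0"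
    then have "(\<Sum>k\<in>UNIV. (L *v v) $ k *s X k) = 0" by simp
    then show False using L(2)[of v] v(1) by simp
  qed
  then obtain k where k: "(L *v v) $ k \<noteq> 0" ..
  have "(L *v (s *s v)) $ k = e k * (L *v v) $ k"
    using eigenbasis_coordinates[OF X L, of v k] by (simp only: v(2))
  then have "s * (L *v v) $ k = e k * (L *v v) $ k" by (simp add: vec.scale)
  then show "s \<in> range e" using k by simp
qed

section \<open>Decay of closed-loop trajectories\<close>

lemma tendsto_0_if_coordinates:
  fixes \<xi> :: "'t \<Rightarrow> real^'n"
  assumes L: "\<And>u. u = (\<Sum>k\<in>UNIV. (L *v u) $ k *s X k)"
    and "\<And>k. ((\<lambda>t. (L *v cvec (\<xi> t)) $ k) \<longlongrightarrow> 0) G"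
  shows "(\<xi> \<longlongrightarrow> 0) G"
proof (rule vec_tendstoI)
  fix j
  have "\<xi> t $ j = Re (\<Sum>k\<in>UNIV. (L *v cvec (\<xi> t)) $ k * X k $ j)" for t
  proof -
    have "cvec (\<xi> t) $ j = (\<Sum>k\<in>UNIV. (L *v cvec (\<xi> t)) $ k * X k $ j)"
      by (subst L) simp
    then show ?thesis by (metis Re_complex_of_real cvec_nth)
  qed
  moreover have "((\<lambda>t. Re (\<Sum>k\<in>UNIV. (L *v cvec (\<xi> t)) $ k * X k $ j)) \<longlongrightarrow>
      Re (\<Sum>k\<in>UNIV. 0 * X k $ j)) G"
    by (intro tendsto_intros assms(2))
  ultimately show "((\<lambda>t. \<xi> t $ j) \<longlongrightarrow> 0 $ j) G" by simp
qed

text \<open>Tracking quantifies over all trajectories, so every solution has to be known. The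
  integrating factor \<open>exp (- t e)\<close> shows that each one is a constant multiple of
  \<open>exp (t e)\<close>.\<close>

lemma scalar_ode_decay:
  fixes c :: "real \<Rightarrow> complex"
  assumes "\<And>t. t \<ge> 0 \<Longrightarrow> (c has_vector_derivative e * c t) (at t within {0..})" "Re e < 0"
  shows "(c \<longlongrightarrow> 0) at_top"
proof -
  have "\<exists>K. \<forall>t\<in>{0..}. c t * exp (- (of_real t * e)) = K"
  proof (rule has_vector_derivative_zero_constant)
    fix t :: real assume "t \<in> {0..}"
    then have c: "(c has_vector_derivative e * c t) (at t within {0..})" using assms(1) by simp
    have "((\<lambda>z. exp (- (z * e))) has_field_derivative - e * exp (- (of_real t * e)))
        (at (of_real t))"
      by (auto intro!: derivative_eq_intros)
    then have "((\<lambda>t. exp (- (of_real t * e))) has_vector_derivative - e * exp (- (of_real t * e)))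
        (at t within {0..})"
      using has_vector_derivative_real_field has_vector_derivative_at_within by blast
    from has_vector_derivative_mult[OF c this]
    show "((\<lambda>t. c t * exp (- (of_real t * e))) has_vector_derivative 0) (at t within {0..})"
      by (simp add: algebra_simps)
  qed auto
  then obtain K where K: "\<And>t. t \<ge> 0 \<Longrightarrow> c t * exp (- (of_real t * e)) = K" by auto
  have c: "c t = K * exp (of_real t * e)" if "t \<ge> 0" for t
    using K[OF that] by (auto simp: exp_minus field_simps)
  have "((\<lambda>t. exp (t * Re e)) \<longlongrightarrow> 0) at_top"
    using assms(2) by real_asymp
  then have "((\<lambda>t. norm (exp (of_real t * e))) \<longlongrightarrow> 0) at_top" by (simp add: norm_exp_eq_Re)
  then have "((\<lambda>t. K * exp (of_real t * e)) \<longlongrightarrow> 0) at_top"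
    by (intro tendsto_mult_right_zero) (rule tendsto_norm_zero_cancel)
  then show ?thesis
    by (rule Lim_transform_eventually) (auto simp: c eventually_at_top_linorder intro!: exI[of _ 0])
qed

lemma eigenbasis_ode_decay:
  fixes M :: "real^'n^'n" and X :: "'n \<Rightarrow> complex^'n"
  assumes X: "inj X" "vec.independent (range X)" "\<And>k. cmat M *v X k = e k *s X k"
    and "\<And>k. Re (e k) < 0"
    and \<xi>: "\<And>t. t \<ge> 0 \<Longrightarrow> (\<xi> has_vector_derivative M *v \<xi> t) (at t within {0..})"
  shows "(\<xi> \<longlongrightarrow> 0) at_top"
proof -
  obtain L where L: "\<And>k. L *v X k = axis k 1" "\<And>u. u = (\<Sum>k\<in>UNIV. (L *v u) $ k *s X k)"
    using basis_coordinates[OF X(1,2)] by blast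
  show ?thesis
  proof (rule tendsto_0_if_coordinates[OF L(2)])
    fix k
    have "linear (\<lambda>x. (L *v cvec x) $ k)"
      by (rule linearI) (simp_all add: matrix_vector_mult_def algebra_simps sum.distrib sum_distrib_left
          scaleR_conv_of_real[where 'a = complex])
    then have "bounded_linear (\<lambda>x. (L *v cvec x) $ k)"
      by (simp add: linear_conv_bounded_linear)
    from bounded_linear.has_vector_derivative[OF this \<xi>]
    have "((\<lambda>t. (L *v cvec (\<xi> t)) $ k) has_vector_derivative e k * (L *v cvec (\<xi> t)) $ k)
      (at t within {0..})" if "t \<ge> 0" for t
      using that by (simp add: cmat_mult_cvec[symmetric] eigenbasis_coordinates[OF X L])
    then show "((\<lambda>t. (L *v cvec (\<xi> t)) $ k) \<longlongrightarrow> 0) at_top"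
      using assms(4) by (rule scalar_ode_decay)
  qed
qed

lemma eigenbasis_difference_decay:
  fixes M :: "real^'n^'n" and X :: "'n \<Rightarrow> complex^'n"
  assumes X: "inj X" "vec.independent (range X)" "\<And>k. cmat M *v X k = e k *s X k"
    and "\<And>k. cmod (e k) < 1" and \<xi>: "\<And>t. \<xi> (Suc t) = M *v \<xi> t"
  shows "\<xi> \<longlonglongrightarrow> 0"
proof -
  obtain L where L: "\<And>k. L *v X k = axis k 1" "\<And>u. u = (\<Sum>k\<in>UNIV. (L *v u) $ k *s X k)"
    using basis_coordinates[OF X(1,2)] by blast
  show ?thesis
  proof (rule tendsto_0_if_coordinates[OF L(2)])
    fix k
    have eq: "(L *v cvec (\<xi> t)) $ k = e k ^ t * (L *v cvec (\<xi> 0)) $ k" for t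
      by (induction t) (simp_all add: \<xi> cmat_mult_cvec[symmetric] eigenbasis_coordinates[OF X L])
    have "(\<lambda>t. e k ^ t * (L *v cvec (\<xi> 0)) $ k) \<longlonglongrightarrow> 0"
      using assms(4) by (intro tendsto_mult_left_zero LIMSEQ_power_zero)
    then show "(\<lambda>t. (L *v cvec (\<xi> t)) $ k) \<longlonglongrightarrow> 0"
      unfolding eq[abs_def, symmetric] .
  qed
qed

section \<open>Static gain and tracking\<close>

lemma dc_point_unstable: "complex_of_real (dc_point T) \<notin> stable_region T"
  by (cases T) (simp_all add: dc_point_def stable_region_def)

text \<open>Full row rank gives a complex solution of the inhomogeneous pencil equation. Since all
  coefficients and the right-hand side are real, its real part is a solution as well.\<close>

lemma real_pencil_solution:
  fixes A :: "real^'n^'n" and B :: "real^'m^'n" and C :: "real^'n^'p" and D :: "real^'m^'p"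
  assumes "rank (eval_mat (system_pencil A B C D) (complex_of_real s)) = CARD('n + 'p)"
  obtains x u where "A *v x + B *v u = s *s x" "C *v x + D *v u = y"
proof -
  obtain Q where Q: "eval_mat (system_pencil A B C D) (complex_of_real s) ** Q = mat 1"
    using right_inverse_if_full_row_rank[OF assms] by blast
  obtain v w where vw: "Q *v vjoin 0 (cvec y) = vjoin v w" using vjoin_split by blast
  have "eval_mat (system_pencil A B C D) (complex_of_real s) *v vjoin v w = vjoin 0 (cvec y)"
    unfolding vw[symmetric] by (simp add: matrix_vector_mul_assoc Q)
  then have vw: "cmat A *v v + cmat B *v w = complex_of_real s *s v" "cmat C *v v + cmat D *v w = cvec y"
    by (simp_all add: eval_system_pencil vjoin_eq_iff pencil_eq_iff)
  have Re1: "A *v (\<chi> k. Re (v $ k)) = (\<chi> k. Re ((cmat A *v v) $ k))"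
    "C *v (\<chi> k. Re (v $ k)) = (\<chi> k. Re ((cmat C *v v) $ k))"
    "B *v (\<chi> k. Re (w $ k)) = (\<chi> k. Re ((cmat B *v w) $ k))"
    "D *v (\<chi> k. Re (w $ k)) = (\<chi> k. Re ((cmat D *v w) $ k))"
    by (simp_all add: vec_eq_iff matrix_vector_mult_def)
  show thesis
  proof
    show "A *v (\<chi> k. Re (v $ k)) + B *v (\<chi> k. Re (w $ k)) = s *s (\<chi> k. Re (v $ k))"
      using arg_cong[OF vw(1), of "\<lambda>v. \<chi> k. Re (v $ k)"] by (simp add: Re1 vec_eq_iff)
    show "C *v (\<chi> k. Re (v $ k)) + D *v (\<chi> k. Re (w $ k)) = y"
      using arg_cong[OF vw(2), of "\<lambda>v. \<chi> k. Re (v $ k)"] by (simp add: Re1 vec_eq_iff)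
  qed
qed

lemma invertible_if_not_eigenvalue:
  fixes M :: "real^'n^'n"
  assumes "complex_of_real s \<notin> eigenvalues M"
  shows "invertible (mat s - M)"
  unfolding invertible_left_inverse matrix_left_invertible_ker
proof (intro allI impI, rule ccontr)
  fix x assume x: "(mat s - M) *v x = 0" "x \<noteq> 0"
  then have "M *v x = s *s x"
    by (simp add: matrix_vector_mult_diff_rdistrib mat_vector_mult)
  then have "cmat M *v cvec x = complex_of_real s *s cvec x"
    by (simp add: cmat_mult_cvec vec_eq_iff)
  moreover have "cvec x \<noteq> 0" using x(2) by (simp add: vec_eq_iff)
  ultimately show False using assms by (auto simp: eigenvalues_def)
qed

lemma matrix_inv_inverse:
  assumes "invertible M"
  shows "M ** matrix_inv M = mat 1" "matrix_inv M ** M = mat 1"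
proof -
  have "M ** matrix_inv M = mat 1 \<and> matrix_inv M ** M = mat 1"
    unfolding matrix_inv_def by (rule someI_ex) (use assms in \<open>simp only: invertible_def\<close>)
  then show "M ** matrix_inv M = mat 1" "matrix_inv M ** M = mat 1" by auto
qed

text \<open>Full rank at the dc point means that every constant output is attained at some
  equilibrium, which makes the static gain surjective and provides \<open>G\<close>. The deviation
  from the equilibrium that belongs to a reference obeys the homogeneous closed loop and decays
  along the eigenbasis.\<close>

lemma tracking_gain_exists:
  fixes A :: "real^'n^'n" and B :: "real^'m^'n" and C :: "real^'n^'p" and D :: "real^'m^'p"
    and F :: "real^'n^'m" and X :: "'n \<Rightarrow> complex^'n"
  assumes rank: "rank (eval_mat (system_pencil A B C D) (complex_of_real (dc_point T))) = CARD('n + 'p)"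
    and X: "inj X" "vec.independent (range X)" "\<And>k. cmat (A + B ** F) *v X k = e k *s X k"
    and stable: "\<And>k. e k \<in> stable_region T"
  shows "\<exists>G. static_gain T A B C D F ** G = mat 1 \<and> tracks_constant_references T A B C D F G"
proof -
  let ?M = "A + B ** F" and ?H = "matrix_inv (mat (dc_point T) - (A + B ** F))"
  let ?K = "static_gain T A B C D F"
  have "eigenvalues ?M \<subseteq> stable_region T"
    using eigenvalues_subset_eigenbasis[OF X] stable by blast
  then have inv: "invertible (mat (dc_point T) - ?M)"
    using dc_point_unstable by (intro invertible_if_not_eigenvalue) blast
  have K: "?K *v u = (C + D ** F) *v (?H *v (B *v u)) + D *v u" for u
    by (simp add: static_gain_def matrix_add_vector_mult matrix_vector_mul_assoc matrix_mul_assoc)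
  have M: "?M *v x = A *v x + B *v (F *v x)" "(C + D ** F) *v x = C *v x + D *v (F *v x)" for x
    by (simp_all add: matrix_add_vector_mult matrix_vector_mul_assoc)
  have "\<exists>u. ?K *v u = y" for y
  proof -
    obtain x u where xu: "A *v x + B *v u = dc_point T *s x" "C *v x + D *v u = y"
      using real_pencil_solution[OF rank] by blast
    \<comment> \<open>An open-loop equilibrium \<open>x\<close> with input \<open>u\<close> is one
      of the closed loop once \<open>u - F x\<close> is added as external input. The output is
      \<open>y\<close> in both cases.\<close>
    have "(mat (dc_point T) - ?M) *v x = B *v (u - F *v x)"
      unfolding matrix_vector_mult_diff_rdistrib mat_vector_mult xu(1)[symmetric] M
      by (simp add: matrix_vector_mult_diff_distrib)
    then have "?H *v (B *v (u - F *v x)) = x"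
      using matrix_inv_inverse(2)[OF inv] by (metis matrix_vector_mul_assoc matrix_vector_mul_lid)
    then have "?K *v (u - F *v x) = y"
      unfolding K by (simp add: M matrix_vector_mult_diff_distrib xu(2))
    then show ?thesis ..
  qed
  then have "surj ((*v) ?K)" by (metis surjI)
  then obtain G where G: "?K ** G = mat 1"
    using matrix_right_invertible_surjective[of ?K] by auto
  \<comment> \<open>\<open>x0\<close> is the equilibrium for the reference \<open>r\<close>. As
    \<open>G\<close> is a right inverse of the static gain, the output there is \<open>r\<close>,
    and the error elsewhere is linear in the deviation from \<open>x0\<close>.\<close>
  have steady: "\<exists>x0. ?M *v x0 + B *v (G *v r) = dc_point T *s x0 \<and>
      (\<forall>x. C *v x + D *v (F *v x + G *v r) = (C + D ** F) *v (x - x0) + r)" for r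
  proof -
    define x0 where "x0 = ?H *v (B *v (G *v r))"
    have "(mat (dc_point T) - ?M) *v x0 = B *v (G *v r)"
      unfolding x0_def using matrix_inv_inverse(1)[OF inv]
      by (metis matrix_vector_mul_assoc matrix_vector_mul_lid)
    then have "B *v (G *v r) = dc_point T *s x0 - ?M *v x0"
      by (simp only: matrix_vector_mult_diff_rdistrib mat_vector_mult)
    then have "?M *v x0 + B *v (G *v r) = dc_point T *s x0"
      by (simp only: eq_diff_eq add.commute)
    moreover have out: "D *v (G *v r) = r - (C + D ** F) *v x0"
    proof -
      have "r = ?K *v (G *v r)" by (simp add: matrix_vector_mul_assoc G)
      then have "r = (C + D ** F) *v x0 + D *v (G *v r)" unfolding K x0_def .
      then show ?thesis by (simp only: eq_diff_eq add.commute)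
    qed
    have "C *v x + D *v (F *v x + G *v r) = (C + D ** F) *v (x - x0) + r" for x
    proof -
      have "C *v x + D *v (F *v x + G *v r) = (C + D ** F) *v x + D *v (G *v r)"
        by (simp only: M matrix_vector_right_distrib add.assoc)
      then show ?thesis by (simp add: out matrix_vector_mult_diff_distrib)
    qed
    ultimately show ?thesis by blast
  qed
  have out0: "((\<lambda>t. (C + D ** F) *v \<xi> t + r) \<longlongrightarrow> r) G'" if "(\<xi> \<longlongrightarrow> 0) G'" for \<xi> :: "'t \<Rightarrow> real^'n" and r G'
    using tendsto_add[OF bounded_linear.tendsto_zero[OF matrix_vector_mul_bounded_linear that] tendsto_const, of "C + D ** F" r]
    by simp
  have "tracks_constant_references T A B C D F G"
  proof (cases T)
    case Continuous
    show ?thesis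
      unfolding tracks_constant_references_def Continuous time_domain.case
    proof (intro allI impI)
      fix r and x :: "real \<Rightarrow> real^'n"
      assume x: "\<forall>t\<ge>0. (x has_vector_derivative A *v x t + B *v (F *v x t + G *v r)) (at t within {0..})"
      \<comment> \<open>The dc point is 0 in continuous time, so the equilibrium makes the
        right-hand side vanish; in discrete time it is 1 and the equilibrium is a fixed
        point.\<close>
      obtain x0 where x0: "?M *v x0 + B *v (G *v r) = 0"
        "\<And>x. C *v x + D *v (F *v x + G *v r) = (C + D ** F) *v (x - x0) + r"
        using steady[of r] unfolding Continuous dc_point_def time_domain.case by auto
      have "((\<lambda>t. x t - x0) has_vector_derivative ?M *v (x t - x0)) (at t within {0..})" if "t \<ge> 0" for t
      proof -
        have "A *v x t + B *v (F *v x t + G *v r) = ?M *v x t + B *v (G *v r)"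
          by (simp add: M matrix_vector_right_distrib)
        also have "\<dots> = ?M *v (x t - x0) + (?M *v x0 + B *v (G *v r))"
          by (simp add: matrix_vector_mult_diff_distrib)
        finally have "?M *v (x t - x0) = A *v x t + B *v (F *v x t + G *v r) - 0"
          by (simp add: x0(1))
        moreover have "((\<lambda>t. x t - x0) has_vector_derivative A *v x t + B *v (F *v x t + G *v r) - 0)
            (at t within {0..})"
          by (intro has_vector_derivative_diff has_vector_derivative_const x[rule_format] that)
        ultimately show ?thesis by (simp only:)
      qed
      then have "((\<lambda>t. x t - x0) \<longlongrightarrow> 0) at_top"
        using stable by (intro eigenbasis_ode_decay[OF X]) (auto simp: Continuous stable_region_def)
      from out0[OF this]
      show "((\<lambda>t. C *v x t + D *v (F *v x t + G *v r)) \<longlongrightarrow> r) at_top"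
        by (simp add: x0(2))
    qed
  next
    case Discrete
    show ?thesis
      unfolding tracks_constant_references_def Discrete time_domain.case
    proof (intro allI impI)
      fix r and x :: "nat \<Rightarrow> real^'n"
      assume x: "\<forall>t. x (Suc t) = A *v x t + B *v (F *v x t + G *v r)"
      obtain x0 where x0: "?M *v x0 + B *v (G *v r) = x0"
        "\<And>x. C *v x + D *v (F *v x + G *v r) = (C + D ** F) *v (x - x0) + r"
        using steady[of r] unfolding Discrete dc_point_def time_domain.case by auto
      have "x (Suc t) - x0 = ?M *v (x t - x0)" for t
      proof -
        have "x (Suc t) = ?M *v x t + B *v (G *v r)"
          by (simp add: x[rule_format] M matrix_vector_right_distrib)
        then have "x (Suc t) - (?M *v x0 + B *v (G *v r)) = ?M *v (x t - x0)"
          by (simp add: matrix_vector_mult_diff_distrib)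
        then show ?thesis by (simp only: x0(1))
      qed
      then have "(\<lambda>t. x t - x0) \<longlonglongrightarrow> 0"
        using stable by (intro eigenbasis_difference_decay[OF X]) (auto simp: Discrete stable_region_def)
      from out0[OF this]
      show "(\<lambda>t. C *v x t + D *v (F *v x t + G *v r)) \<longlonglongrightarrow> r"
        by (simp add: x0(2))
    qed
  qed
  then show ?thesis using G by blast
qed

section \<open>Necessity\<close>

lemma zero_in_sum_of_sets:
  fixes S :: "'i \<Rightarrow> 'a::comm_monoid_add set"
  assumes "finite I" "\<And>i. i \<in> I \<Longrightarrow> 0 \<in> S i"
  shows "0 \<in> sum S I"
  using assms
proof (induction I)
  case (insert i I)
  then have "0 + 0 \<in> S i + sum S I" by (intro set_plus_intro) auto
  then show ?case using insert by simp
qed simp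

lemma in_set_plus:
  fixes X Y :: "'a::comm_monoid_add set"
  shows "0 \<in> Y \<Longrightarrow> x \<in> X \<Longrightarrow> x \<in> X + Y" "0 \<in> X \<Longrightarrow> y \<in> Y \<Longrightarrow> y \<in> X + Y"
  using set_plus_intro[of x X 0 Y] set_plus_intro[of 0 X y Y] by auto

lemma in_sum_of_sets:
  fixes S :: "'i \<Rightarrow> 'a::comm_monoid_add set"
  assumes "finite I" "\<And>i. i \<in> I \<Longrightarrow> 0 \<in> S i" "i \<in> I" "x \<in> S i"
  shows "x \<in> sum S I"
proof -
  have "0 \<in> sum S (I - {i})" using assms by (intro zero_in_sum_of_sets) auto
  then have "x \<in> S i + sum S (I - {i})" using assms(4) by (intro in_set_plus(1))
  then show ?thesis using assms by (simp add: sum.remove)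
qed

lemma set_plus_subset_span:
  fixes X Y :: "('a::field^'n) set"
  assumes "X \<subseteq> vec.span U" "Y \<subseteq> vec.span U"
  shows "X + Y \<subseteq> vec.span U"
  using assms vec.span_add by (fastforce elim!: set_plus_elim)

lemma sum_of_sets_subset_span:
  fixes S :: "'i \<Rightarrow> ('a::field^'n) set"
  assumes "finite I" "\<And>i. i \<in> I \<Longrightarrow> S i \<subseteq> vec.span U"
  shows "sum S I \<subseteq> vec.span U"
  using assms
proof (induction I)
  case (insert i I)
  then have "S i + sum S I \<subseteq> vec.span U" by (intro set_plus_subset_span) auto
  then show ?case using insert by simp
qed (simp add: vec.span_zero)

text \<open>A summand is contained in a Minkowski sum because the other summands contain 0. Hence an
  eigenvector found in one component lies in the whole sum.\<close>

lemma zero_in_components: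
  "0 \<in> \<E> T A B C D z i" "0 \<in> cnj_vec ` \<E> T A B C D z i" "0 \<in> R_c A B C D k s"
proof -
  show E: "0 \<in> \<E> T A B C D z i" by (simp add: \<E>_def vec.span_zero)
  show "0 \<in> cnj_vec ` \<E> T A B C D z i" using imageI[OF E, of cnj_vec] by simp
  show "0 \<in> R_c A B C D k s" by (simp add: R_c_def vec.span_zero)
qed

lemma feedback_solves:
  assumes "cmat (A + B ** F) *v v = s *s v"
  shows "solves_pencil A B C D s v (cmat F *v v) (cmat (C + D ** F) *v v)"
  using assms by (simp add: solves_pencil_def cmat_feedback_mult)

lemma odd_pairs:
  "{1..2 * c} = {i \<in> {1..2 * c}. odd i} \<union> Suc ` {i \<in> {1..2 * c}. odd i}"
proof -
  have "i \<in> Suc ` {i \<in> {1..2 * c}. odd i}" if "i \<in> {1..2 * c}" "even i" for i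
    using that by (intro image_eqI[of _ _ "i - 1"]) auto
  moreover have "Suc i \<in> {1..2 * c}" if "i \<in> {1..2 * c}" "odd i" for i
    using that unfolding atLeastAtMost_iff by presburger
  ultimately show ?thesis by blast
qed

lemma sum_odd_pairs:
  fixes f :: "nat \<Rightarrow> 'a::comm_monoid_add"
  shows "(\<Sum>i\<in>{1..2 * c}. f i) = (\<Sum>i | i \<in> {1..2 * c} \<and> odd i. f i + f (Suc i))"
proof -
  have "(\<Sum>i\<in>{1..2 * c}. f i) = (\<Sum>i\<in>{i \<in> {1..2 * c}. odd i} \<union> Suc ` {i \<in> {1..2 * c}. odd i}. f i)"
    using odd_pairs[of c] by (rule sum.cong) simp
  also have "\<dots> = (\<Sum>i\<in>{i \<in> {1..2 * c}. odd i}. f i) + (\<Sum>i\<in>Suc ` {i \<in> {1..2 * c}. odd i}. f i)"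
    by (intro sum.union_disjoint) auto
  also have "(\<Sum>i\<in>Suc ` {i \<in> {1..2 * c}. odd i}. f i) = (\<Sum>i\<in>{i \<in> {1..2 * c}. odd i}. f (Suc i))"
    by (subst sum.reindex) auto
  finally show ?thesis by (simp add: sum.distrib)
qed

lemma independent_family_subset:
  assumes "inj_on f K" "vec.independent (f ` K)" "J \<subseteq> K" "f ` J \<subseteq> W"
  shows "card J \<le> vec.dim W"
proof -
  have "vec.independent (f ` J)" using assms(2,3) by (meson image_mono vec.independent_mono)
  then have "card (f ` J) \<le> vec.dim W" using assms(4) by (rule vec.independent_card_le_dim[rotated])
  then show ?thesis using inj_on_subset[OF assms(1,3)] by (simp add: card_image)
qed

text \<open>Take \<mu> i as the number of unobservable eigenvectors at \<open>z i\<close>, and \<mu>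
  0 as the number of those at eigenvalues that are no nonreal minimum-phase zeros. The basis vectors
  in the groups selected by \<open>Q0\<close>, \<open>Q\<close>, \<open>Q'\<close> and
  \<open>P\<close> lie in the sum, and distinct groups share no index, so the right-hand side counts
  independent vectors.\<close>

lemma dimension_condition_necessary:
  fixes T :: time_domain
    and A :: "real^'n^'n" and B :: "real^'m^'n" and C :: "real^'n^'p" and D :: "real^'m^'p"
    and z :: "nat \<Rightarrow> complex" and c :: nat
  defines "O1 \<equiv> {i \<in> {1..2 * c}. odd i}"
  assumes z: "bij_betw z {1..2 * c} (nonreal_minimum_phase_zeros T A B C D)"
    and zcnj: "\<forall>i\<in>{1..2 * c}. odd i \<longrightarrow> z (i + 1) = cnj (z i)"
    and sol: "problem_1B_solvable T A B C D \<nu>0 \<nu> lam"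
  shows "\<exists>\<mu> :: nat \<Rightarrow> nat. \<mu> 0 + (\<Sum>i\<in>O1. 2 * \<mu> i) = \<nu>0 \<and>
    (\<forall>Q0 \<in> Pow {0}. \<forall>Q \<in> Pow O1. \<forall>Q' \<in> Pow O1. \<forall>P \<in> Pow (SIGMA i:UNIV. {1..\<nu> i}).
      (\<Sum>i\<in>Q0. \<mu> i) + (\<Sum>i\<in>Q. \<mu> i) + (\<Sum>i\<in>Q'. \<mu> i) + card P \<le>
      vec.dim ((\<Sum>i\<in>Q0. \<E> T A B C D z i) + (\<Sum>i\<in>Q. \<E> T A B C D z i)
        + (\<Sum>i\<in>Q'. cnj_vec ` \<E> T A B C D z i)
        + (\<Sum>(i, j)\<in>P. R_c A B C D i (complex_of_real (lam i j)))))"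
proof -
  let ?Z = "nonreal_minimum_phase_zeros T A B C D"
  define K where "K = (SIGMA k:UNIV. {1..case_option \<nu>0 \<nu> k})"
  obtain F :: "real^'n^'m" and ev and v :: "'p option \<Rightarrow> nat \<Rightarrow> complex^'n" where
    stable: "eigenvalues (A + B ** F) \<subseteq> stable_region T"
    and dec: "decoupling_eigenbasis A B C D F (case_option \<nu>0 \<nu>) ev v"
    and lam: "\<And>i j. j \<in> {1..\<nu> i} \<Longrightarrow> ev (Some i) j = complex_of_real (lam i j)"
    using sol unfolding problem_1B_solvable_def by blast
  have inj: "inj_on (\<lambda>(k, j). v k j) K" and ind: "vec.independent ((\<lambda>(k, j). v k j) ` K)"
    using dec unfolding decoupling_eigenbasis_def K_def Let_def by blast+
  have eig: "cmat (A + B ** F) *v v k j = ev k j *s v k j" if "j \<in> {1..case_option \<nu>0 \<nu> k}" for k j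
    using dec that unfolding decoupling_eigenbasis_def by blast
  have real: "cnj_vec (v k j) = v k j" if "j \<in> {1..case_option \<nu>0 \<nu> k}" "ev k j \<in> \<real>" for k j
    using dec that unfolding decoupling_eigenbasis_def by blast
  have paired: "\<exists>j'\<in>{1..\<nu>0}. ev None j' = cnj (ev None j) \<and> v None j' = cnj_vec (v None j)"
    if "j \<in> {1..\<nu>0}" "ev None j \<notin> \<real>" for j
  proof -
    have "j \<in> {1..case_option \<nu>0 \<nu> None}" using that by simp
    then have "\<exists>j'\<in>{1..case_option \<nu>0 \<nu> None}. ev None j' = cnj (ev None j) \<and> v None j' = cnj_vec (v None j)"
      using dec that(2) unfolding decoupling_eigenbasis_def by blast
    then show ?thesis by simp
  qed
  have unobs: "cmat (C + D ** F) *v v None j = 0" if "j \<in> {1..\<nu>0}" for j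
    using dec that unfolding decoupling_eigenbasis_def by auto
  have obs: "\<exists>\<delta>. \<delta> \<noteq> 0 \<and> cmat (C + D ** F) *v v (Some i) j = \<delta> *s axis i 1" if "j \<in> {1..\<nu> i}" for i j
    using dec that unfolding decoupling_eigenbasis_def by auto
  have nz: "v k j \<noteq> 0" if "j \<in> {1..case_option \<nu>0 \<nu> k}" for k j
  proof -
    have "(k, j) \<in> K" using that by (simp add: K_def)
    then have "v k j \<in> (\<lambda>(k, j). v k j) ` K" by force
    then show ?thesis using ind vec.dependent_zero by metis
  qed
  have inR: "v None j \<in> \<R> A B C D (ev None j)" if "j \<in> {1..\<nu>0}" for j
    using feedback_solves[OF eig[of j None], of C D] unobs[OF that] that
    by (auto simp: \<R>_iff_solves)
  have ev_stable: "ev None j \<in> stable_region T" if "j \<in> {1..\<nu>0}" for j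
    using stable eig[of j None] nz[of j None] that unfolding eigenvalues_def by auto
  have inRhat: "v (Some i) j \<in> R_hat A B C D i (complex_of_real (lam i j))" if j: "j \<in> {1..\<nu> i}" for i j
  proof -
    obtain \<delta> where \<delta>: "\<delta> \<noteq> 0" "cmat (C + D ** F) *v v (Some i) j = \<delta> *s axis i 1"
      using obs[OF j] by blast
    \<comment> \<open>The eigenbasis only provides a complex factor, but \<open>R_hat\<close> asks
      for a real one. The eigenvector is real because its eigenvalue is, so its output and hence the
      factor are real.\<close>
    have "cnj_vec (v (Some i) j) = v (Some i) j" using real[of j "Some i"] j lam[OF j] by simp
    then have "cnj_vec (\<delta> *s axis i 1) = (\<delta> *s axis i 1 :: complex^'p)"
      by (metis \<delta>(2) cnj_vec_cmat_mult)
    from arg_cong[OF this, of "\<lambda>y. y $ i"] have "cnj \<delta> = \<delta>" by (simp add: axis_def)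
    then have "\<delta> \<in> \<real>" by (simp add: Reals_cnj_iff)
    then obtain d where d: "\<delta> = complex_of_real d" by (auto elim: Reals_cases)
    have "solves_pencil A B C D (ev (Some i) j) (v (Some i) j) (cmat F *v v (Some i) j)
        (complex_of_real d *s axis i 1)"
      using feedback_solves[OF eig[of j "Some i"], of C D] j \<delta>(2) d by simp
    then show ?thesis using lam[OF j] \<delta>(1) d by (auto simp: R_hat_iff_solves)
  qed
  define N where "N s = {j \<in> {1..\<nu>0}. ev None j = s}" for s
  have finN: "finite (N s)" for s by (simp add: N_def)
  have Ndisj: "N s \<inter> N t = {}" if "s \<noteq> t" for s t
    using that by (auto simp: N_def)
  \<comment> \<open>Any choice of partner indices is injective: equal partners have equal vectors,
    hence equal conjugates, and the basis has no repetitions. Used for a number and its conjugate,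
    this gives equality.\<close>
  have le: "card (N s) \<le> card (N (cnj s))" if "s \<notin> \<real>" for s
  proof -
    have "\<forall>j\<in>N s. \<exists>j'. j' \<in> N (cnj s) \<and> v None j' = cnj_vec (v None j)"
      using paired that by (fastforce simp: N_def)
    from bchoice[OF this] obtain p where p: "\<And>j. j \<in> N s \<Longrightarrow> p j \<in> N (cnj s)"
      "\<And>j. j \<in> N s \<Longrightarrow> v None (p j) = cnj_vec (v None j)" by blast
    have "inj_on p (N s)"
    proof (rule inj_onI)
      fix j k assume jk: "j \<in> N s" "k \<in> N s" "p j = p k"
      then have "v None j = v None k" by (metis p(2) cnj_vec_eq_iff)
      then show "j = k"
        using inj_onD[OF inj, of "(None, j)" "(None, k)"] jk(1,2) by (simp add: K_def N_def)
    qed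
    then show ?thesis using p(1) finN by (meson card_inj_on_le image_subsetI)
  qed
  define \<mu> where "\<mu> i = (if i = 0 then card {j \<in> {1..\<nu>0}. ev None j \<notin> ?Z} else card (N (z i)))" for i
  have zZ: "z i \<in> ?Z" if "i \<in> {1..2 * c}" for i
    using z that by (auto simp: bij_betw_def)
  have zinj: "inj_on z {1..2 * c}" using z by (simp add: bij_betw_def)
  have O1: "i \<in> {1..2 * c}" "Suc i \<in> {1..2 * c}" "i \<noteq> 0" "z (Suc i) = cnj (z i)" "odd i" if "i \<in> O1" for i
    using that zcnj odd_pairs[of c] unfolding O1_def by auto
  have \<mu>: "\<mu> i = card (N (z i))" "\<mu> i = card (N (z (Suc i)))" if "i \<in> O1" for i
  proof -
    show "\<mu> i = card (N (z i))" using O1[OF that] by (simp add: \<mu>_def)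
    have "z i \<notin> \<real>" using zZ[OF O1(1)[OF that]] by (simp add: nonreal_minimum_phase_zeros_def)
    then have "card (N (z i)) = card (N (cnj (z i)))"
      using le[of "z i"] le[of "cnj (z i)"] by (auto simp: Reals_cnj_iff)
    then show "\<mu> i = card (N (z (Suc i)))" using O1[OF that] by (simp add: \<mu>_def)
  qed
  have "?Z = z ` {1..2 * c}" using z by (simp add: bij_betw_def)
  then have "{1..\<nu>0} = {j \<in> {1..\<nu>0}. ev None j \<notin> ?Z} \<union> (\<Union>i\<in>{1..2 * c}. N (z i))"
    unfolding N_def by blast
  moreover have "card ({j \<in> {1..\<nu>0}. ev None j \<notin> ?Z} \<union> (\<Union>i\<in>{1..2 * c}. N (z i))) =
      \<mu> 0 + card (\<Union>i\<in>{1..2 * c}. N (z i))"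
    unfolding \<mu>_def using zZ finN by (subst card_Un_disjoint) (auto simp: N_def)
  moreover have "card (\<Union>i\<in>{1..2 * c}. N (z i)) = (\<Sum>i\<in>{1..2 * c}. card (N (z i)))"
    using finN Ndisj inj_onD[OF zinj] by (intro card_UN_disjoint ballI impI Ndisj) auto
  moreover have "(\<Sum>i\<in>{1..2 * c}. card (N (z i))) = (\<Sum>i\<in>O1. card (N (z i)) + card (N (z (Suc i))))"
    unfolding O1_def by (rule sum_odd_pairs)
  moreover have "(\<Sum>i\<in>O1. card (N (z i)) + card (N (z (Suc i)))) = (\<Sum>i\<in>O1. 2 * \<mu> i)"
    using \<mu> by (intro sum.cong) auto
  ultimately have count: "\<mu> 0 + (\<Sum>i\<in>O1. 2 * \<mu> i) = \<nu>0"
    by (metis card_atLeastAtMost diff_Suc_1)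
  show ?thesis
  proof (intro exI[of _ \<mu>] conjI[OF count] ballI)
    fix Q0 :: "nat set" and Q Q' P
    assume "Q0 \<in> Pow {0}" "Q \<in> Pow O1" "Q' \<in> Pow O1" "P \<in> Pow (SIGMA i:UNIV. {1..\<nu> i})"
    then have sub: "Q0 \<subseteq> {0}" "Q \<subseteq> O1" "Q' \<subseteq> O1" "P \<subseteq> (SIGMA i:UNIV. {1..\<nu> i})"
      by (simp_all only: Pow_iff)
    have fin: "finite Q0" "finite Q" "finite Q'" "finite P"
      using sub by (auto simp: O1_def intro: finite_subset)
    let ?W = "(\<Sum>i\<in>Q0. \<E> T A B C D z i) + (\<Sum>i\<in>Q. \<E> T A B C D z i)
        + (\<Sum>i\<in>Q'. cnj_vec ` \<E> T A B C D z i)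
        + (\<Sum>(i, j)\<in>P. R_c A B C D i (complex_of_real (lam i j)))"
    define J1 where "J1 = (if 0 \<in> Q0 then {j \<in> {1..\<nu>0}. ev None j \<notin> ?Z} else {})"
    define J2 where "J2 = (\<Union>i\<in>Q. N (z i))"
    \<comment> \<open>\<open>Q'\<close> selects the eigenvalues \<open>z (Suc i)\<close>, the
      conjugates of \<open>z i\<close>; their eigenvectors lie in the conjugate of the space at
      \<open>z i\<close>.\<close>
    define J3 where "J3 = (\<Union>i\<in>Q'. N (z (Suc i)))"
    have zero: "0 \<in> (\<Sum>i\<in>Q0. \<E> T A B C D z i)" "0 \<in> (\<Sum>i\<in>Q. \<E> T A B C D z i)"
      "0 \<in> (\<Sum>i\<in>Q'. cnj_vec ` \<E> T A B C D z i)"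
      "0 \<in> (\<Sum>(i, j)\<in>P. R_c A B C D i (complex_of_real (lam i j)))"
      using fin by (auto intro!: zero_in_sum_of_sets zero_in_components)
    have zero2: "0 \<in> X + Y" if "0 \<in> X" "0 \<in> Y" for X Y :: "(complex^'n) set"
      using that by (rule in_set_plus(1)[rotated])
    have W: "x \<in> ?W" if "x \<in> (\<Sum>i\<in>Q0. \<E> T A B C D z i) \<or> x \<in> (\<Sum>i\<in>Q. \<E> T A B C D z i) \<or>
      x \<in> (\<Sum>i\<in>Q'. cnj_vec ` \<E> T A B C D z i) \<or>
      x \<in> (\<Sum>(i, j)\<in>P. R_c A B C D i (complex_of_real (lam i j)))" for x
      using that
    proof (elim disjE)
      assume "x \<in> (\<Sum>i\<in>Q0. \<E> T A B C D z i)"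
      then show ?thesis by (intro in_set_plus(1) zero)
    next
      assume "x \<in> (\<Sum>i\<in>Q. \<E> T A B C D z i)"
      then show ?thesis
        by (intro in_set_plus(1)[OF zero(4)] in_set_plus(1)[OF zero(3)] in_set_plus(2) zero)
    next
      assume "x \<in> (\<Sum>i\<in>Q'. cnj_vec ` \<E> T A B C D z i)"
      then show ?thesis by (intro in_set_plus(1)[OF zero(4)] in_set_plus(2)[OF zero2] zero)
    next
      assume "x \<in> (\<Sum>(i, j)\<in>P. R_c A B C D i (complex_of_real (lam i j)))"
      then show ?thesis by (intro in_set_plus(2)[OF zero2] zero2 zero)
    qed
    have m1: "v None j \<in> ?W" if "j \<in> J1" for j
    proof -
      have "0 \<in> Q0" "j \<in> {1..\<nu>0}" "ev None j \<notin> ?Z" using that by (auto simp: J1_def split: if_splits)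
      moreover from this have "v None j \<in> \<E> T A B C D z 0"
        using inR ev_stable by (auto simp: \<E>_def E_g_def intro!: vec.span_base)
      ultimately have "v None j \<in> (\<Sum>i\<in>Q0. \<E> T A B C D z i)"
        using fin by (intro in_sum_of_sets[of Q0 _ 0] zero_in_components)
      then show ?thesis by (intro W) blast
    qed
    have m2: "v None j \<in> ?W" if "j \<in> J2" for j
    proof -
      obtain i where i: "i \<in> Q" "j \<in> {1..\<nu>0}" "ev None j = z i" using \<open>j \<in> J2\<close> by (auto simp: J2_def N_def)
      moreover from this have "v None j \<in> \<E> T A B C D z i"
        using inR[of j] O1(3)[of i] sub(2) by (auto simp: \<E>_def E_g_def intro!: vec.span_base)
      ultimately have "v None j \<in> (\<Sum>i\<in>Q. \<E> T A B C D z i)"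
        using fin by (intro in_sum_of_sets[of Q _ i] zero_in_components)
      then show ?thesis by (intro W) blast
    qed
    have m3: "v None j \<in> ?W" if "j \<in> J3" for j
    proof -
      obtain i where i: "i \<in> Q'" "j \<in> {1..\<nu>0}" "ev None j = z (Suc i)" using \<open>j \<in> J3\<close> by (auto simp: J3_def N_def)
      then have "i \<in> O1" using sub(3) by blast
      have "cnj_vec (v None j) \<in> \<R> A B C D (z i)"
        using cnj_vec_\<R>[OF inR[OF i(2)]] i(3) O1(4)[OF \<open>i \<in> O1\<close>] by simp
      then have "cnj_vec (v None j) \<in> \<E> T A B C D z i"
        using O1(3)[OF \<open>i \<in> O1\<close>] by (auto simp: \<E>_def E_g_def intro!: vec.span_base)
      then have "v None j \<in> cnj_vec ` \<E> T A B C D z i"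
        by (metis cnj_vec_cnj_vec imageI)
      with i(1) have "v None j \<in> (\<Sum>i\<in>Q'. cnj_vec ` \<E> T A B C D z i)"
        using fin by (intro in_sum_of_sets[of Q' _ i] zero_in_components)
      then show ?thesis by (intro W) blast
    qed
    have m4: "v (Some i) j \<in> ?W" if "(i, j) \<in> P" for i j
    proof -
      have "v (Some i) j \<in> R_c A B C D i (complex_of_real (lam i j))"
        using inRhat[of j i] that sub(4) by (auto simp: R_c_def intro!: vec.span_base)
      then have "v (Some i) j \<in> (\<Sum>(i, j)\<in>P. R_c A B C D i (complex_of_real (lam i j)))"
        using fin that by (intro in_sum_of_sets[of P _ "(i, j)"]) (auto intro: zero_in_components)
      then show ?thesis by (intro W) blast
    qed
    define J where "J = Pair None ` (J1 \<union> J2 \<union> J3) \<union> (\<lambda>(i, j). (Some i, j)) ` P"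
    have finJ: "finite J1" "finite J2" "finite J3"
      using fin finN by (auto simp: J1_def J2_def J3_def)
    have "J1 \<union> J2 \<union> J3 \<subseteq> {1..\<nu>0}"
      by (auto simp: J1_def J2_def J3_def N_def)
    then have "J \<subseteq> K" using sub(4) by (fastforce simp: J_def K_def)
    moreover have "(\<lambda>(k, j). v k j) ` J \<subseteq> ?W"
      using m1 m2 m3 m4 by (auto simp: J_def)
    ultimately have "card J \<le> vec.dim ?W"
      by (rule independent_family_subset[OF inj ind])
    moreover have "card J = card (J1 \<union> J2 \<union> J3) + card P"
    proof -
      have "card J = card (Pair (None :: 'p option) ` (J1 \<union> J2 \<union> J3)) + card ((\<lambda>(i, j). (Some i, j)) ` P)"
        unfolding J_def using finJ fin by (intro card_Un_disjoint) auto
      moreover have "inj_on (\<lambda>(i, j). (Some i, j)) P" by (auto intro!: inj_onI)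
      moreover have "inj_on (Pair (None :: 'p option)) (J1 \<union> J2 \<union> J3)" by (auto intro!: inj_onI)
      ultimately show ?thesis by (simp only: card_image)
    qed
    moreover have "card (J1 \<union> J2 \<union> J3) = card J1 + card J2 + card J3"
    proof -
      have Z23: "ev None j \<in> ?Z" if j: "j \<in> J2 \<union> J3" for j
      proof -
        obtain i where "i \<in> O1" "ev None j = z i \<or> ev None j = z (Suc i)"
          using j sub(2,3) unfolding J2_def J3_def N_def by blast
        then show ?thesis using zZ O1(1,2) by metis
      qed
      then have "J1 \<inter> (J2 \<union> J3) = {}" by (auto simp: J1_def split: if_splits)
      moreover have "J2 \<inter> J3 = {}"
      proof -
        \<comment> \<open>Both indices are odd, so \<open>Suc k\<close> is even and differs from
          \<open>i\<close>. Thus \<open>J2\<close> and \<open>J3\<close> are disjoint even if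
          \<open>Q\<close> and \<open>Q'\<close> overlap.\<close>
        have "z i \<noteq> z (Suc k)" if "i \<in> O1" "k \<in> O1" for i k
        proof
          assume "z i = z (Suc k)"
          then have "i = Suc k" using inj_onD[OF zinj] O1(1)[OF that(1)] O1(2)[OF that(2)] by blast
          then show False using O1(5)[OF that(1)] O1(5)[OF that(2)] by simp
        qed
        then have "N (z i) \<inter> N (z (Suc k)) = {}" if "i \<in> Q" "k \<in> Q'" for i k
          using that sub(2,3) by (intro Ndisj) blast
        then show ?thesis unfolding J2_def J3_def by blast
      qed
      ultimately show ?thesis
        using finJ card_Un_disjoint[of J1 "J2 \<union> J3"] card_Un_disjoint[of J2 J3] by (simp add: Un_assoc)
    qed
    moreover have "card J1 = (\<Sum>i\<in>Q0. \<mu> i)"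
      using sub(1) by (auto simp: J1_def \<mu>_def subset_singleton_iff)
    moreover have "card J2 = (\<Sum>i\<in>Q. \<mu> i)"
    proof -
      have "card J2 = (\<Sum>i\<in>Q. card (N (z i)))"
        unfolding J2_def
      proof (intro card_UN_disjoint ballI impI Ndisj)
        fix i k assume "i \<in> Q" "k \<in> Q" "i \<noteq> k"
        then show "z i \<noteq> z k"
          using O1(1)[of i] O1(1)[of k] inj_onD[OF zinj, of i k] sub(2) by blast
      qed (use fin finN in simp_all)
      then show ?thesis using \<mu>(1) sub(2) by (simp add: subset_iff)
    qed
    moreover have "card J3 = (\<Sum>i\<in>Q'. \<mu> i)"
    proof -
      have "i = k" if "i \<in> O1" "k \<in> O1" "z (Suc i) = z (Suc k)" for i k
        using inj_onD[OF zinj that(3)] O1[OF that(1)] O1[OF that(2)] by simp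
      then have "card J3 = (\<Sum>i\<in>Q'. card (N (z (Suc i))))"
        unfolding J3_def using fin finN sub(3)
        by (intro card_UN_disjoint ballI impI Ndisj) auto
      then show ?thesis using \<mu>(2) sub(3) by (simp add: subset_iff)
    qed
    ultimately show "(\<Sum>i\<in>Q0. \<mu> i) + (\<Sum>i\<in>Q. \<mu> i) + (\<Sum>i\<in>Q'. \<mu> i) + card P \<le> vec.dim ?W"
      by linarith
  qed
qed

section \<open>Sufficiency\<close>

lemma independent_family_reindex:
  assumes "bij_betw h UNIV I"
  shows "inj (x \<circ> h) \<and> vec.independent (range (x \<circ> h)) \<longleftrightarrow> inj_on x I \<and> vec.independent (x ` I)"
proof -
  have h: "inj h" "range h = I" using assms by (simp_all add: bij_betw_def)
  then have "inj (x \<circ> h) \<longleftrightarrow> inj_on x I" using comp_inj_on_iff[OF h(1), of x] by simp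
  moreover have "range (x \<circ> h) = x ` I" using h(2) by (metis image_comp)
  ultimately show ?thesis by simp
qed

text \<open>The determinant argument needs a family indexed by the dimension type. A bijection
  between this type and \<open>I\<close> carries the result over.\<close>

lemma conjugate_pair_exchange_family:
  fixes x :: "'i \<Rightarrow> complex^'n"
  assumes "finite I" "card I = CARD('n)" "inj_on x I" "vec.independent (x ` I)"
    and "vec.subspace U" "p \<in> I" "q \<in> I" "p \<noteq> q" "x p \<in> U" "cnj_vec (x q) \<in> U"
  obtains u where "u \<in> U" "inj_on (x(p := u, q := cnj_vec u)) I"
    "vec.independent (x(p := u, q := cnj_vec u) ` I)"
proof -
  obtain h :: "'n \<Rightarrow> 'i" where h: "bij_betw h UNIV I"
    using finite_same_card_bij[of "UNIV :: 'n set" I] assms(1,2) by auto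
  then obtain a b where ab: "h a = p" "h b = q"
    using assms(6,7) by (metis bij_betw_imp_surj_on imageE)
  have inj: "h i = h j \<longleftrightarrow> i = j" for i j using h by (meson bij_betw_def injD)
  have upd: "x(p := u, q := v) \<circ> h = (x \<circ> h)(a := u, b := v)" for u v
    unfolding ab[symmetric] by (rule ext) (simp add: inj)
  have f: "inj (x \<circ> h)" "vec.independent (range (x \<circ> h))"
    using independent_family_reindex[OF h, of x] assms(3,4) by simp_all
  have ne: "a \<noteq> b" and U: "(x \<circ> h) a \<in> U" "cnj_vec ((x \<circ> h) b) \<in> U"
    using ab assms(8-10) by auto
  obtain u where "u \<in> U" "inj ((x \<circ> h)(a := u, b := cnj_vec u))"
    "vec.independent (range ((x \<circ> h)(a := u, b := cnj_vec u)))"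
    by (rule conjugate_pair_exchange[OF assms(5) f ne U])
  then show thesis
    using that[of u] independent_family_reindex[OF h, of "x(p := u, q := cnj_vec u)"] by (simp add: upd)
qed

text \<open>Each exchange touches the positions of one pair only. As the positions of different
  pairs are distinct, repaired pairs stay repaired and the vectors of an untreated pair are still
  the original ones.\<close>

lemma conjugate_pairs_exchange:
  fixes x :: "'i \<Rightarrow> complex^'n" and p q :: "'j \<Rightarrow> 'i"
  assumes I: "finite I" "card I = CARD('n)" "inj_on x I" "vec.independent (x ` I)"
    and "finite S" "inj_on p S" "inj_on q S" "p ` S \<inter> q ` S = {}" "p ` S \<union> q ` S \<subseteq> I"
    and "\<And>t. t \<in> S \<Longrightarrow> vec.subspace (U t) \<and> x (p t) \<in> U t \<and> cnj_vec (x (q t)) \<in> U t"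
  shows "\<exists>x'. inj_on x' I \<and> vec.independent (x' ` I) \<and>
    (\<forall>t\<in>S. x' (p t) \<in> U t \<and> x' (q t) = cnj_vec (x' (p t))) \<and>
    (\<forall>s. s \<notin> p ` S \<union> q ` S \<longrightarrow> x' s = x s)"
  using assms(5-)
proof (induction S rule: finite_induct)
  case empty
  then show ?case using I(3,4) by (intro exI[of _ x]) simp
next
  case (insert t S)
  have "\<exists>x'. inj_on x' I \<and> vec.independent (x' ` I) \<and>
    (\<forall>t\<in>S. x' (p t) \<in> U t \<and> x' (q t) = cnj_vec (x' (p t))) \<and>
    (\<forall>s. s \<notin> p ` S \<union> q ` S \<longrightarrow> x' s = x s)"
    using insert.prems by (intro insert.IH) auto
  then obtain y where y: "inj_on y I" "vec.independent (y ` I)"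
    "\<And>t. t \<in> S \<Longrightarrow> y (p t) \<in> U t \<and> y (q t) = cnj_vec (y (p t))"
    "\<And>s. s \<notin> p ` S \<union> q ` S \<Longrightarrow> y s = x s" by blast
  have new: "p t \<notin> p ` S \<union> q ` S" "q t \<notin> p ` S \<union> q ` S" "p t \<noteq> q t"
    using insert.prems(1,2,3) insert.hyps(2) by auto
  have U: "vec.subspace (U t)" "y (p t) \<in> U t" "cnj_vec (y (q t)) \<in> U t"
    using insert.prems(5)[of t] y(4)[OF new(1)] y(4)[OF new(2)] by simp_all
  have "p t \<in> I" "q t \<in> I" using insert.prems(4) by auto
  then obtain u where u: "u \<in> U t" "inj_on (y(p t := u, q t := cnj_vec u)) I"
    "vec.independent (y(p t := u, q t := cnj_vec u) ` I)"
    by (rule conjugate_pair_exchange_family[OF I(1,2) y(1,2) U(1) _ _ new(3) U(2,3)])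
  let ?x = "y(p t := u, q t := cnj_vec u)"
  have old: "?x (p t') = y (p t')" "?x (q t') = y (q t')" if "t' \<in> S" for t'
    using new imageI[OF that, of p] imageI[OF that, of q] by auto
  have "?x (p t') \<in> U t' \<and> ?x (q t') = cnj_vec (?x (p t'))" if "t' \<in> insert t S" for t'
  proof (cases "t' = t")
    case True
    then show ?thesis using u(1) new(3) by simp
  next
    case False
    then have "t' \<in> S" using that by simp
    show ?thesis unfolding old[OF \<open>t' \<in> S\<close>] by (rule y(3)[OF \<open>t' \<in> S\<close>])
  qed
  moreover have "?x s = x s" if "s \<notin> p ` insert t S \<union> q ` insert t S" for s
    using that y(4)[of s] by auto
  ultimately show ?case using u(2,3) by (intro exI[of _ ?x]) blast
qed

text \<open>One slot for each eigenvector to be found: \<open>Free\<close> for the unobservable ones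
  with a real eigenvalue, \<open>Zero i k\<close> and \<open>Conj i k\<close> for a pair at
  \<open>z i\<close> and its conjugate, \<open>Obs i j\<close> for the assigned eigenvalues.\<close>

datatype 'p slot = Free nat | Zero nat nat | Conj nat nat | Obs 'p nat

text \<open>The involution that conjugation is to induce on the basis; the slots it fixes carry real
  vectors.\<close>

fun partner :: "'p slot \<Rightarrow> 'p slot" where
  "partner (Zero i k) = Conj i k"
| "partner (Conj i k) = Zero i k"
| "partner s = s"

definition unobs_slots :: "nat set \<Rightarrow> (nat \<Rightarrow> nat) \<Rightarrow> 'p slot set" where
  "unobs_slots H \<mu> = Free ` {1..\<mu> 0} \<union>
     (case_prod Zero ` (SIGMA i:H. {1..\<mu> i}) \<union> case_prod Conj ` (SIGMA i:H. {1..\<mu> i}))"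

definition obs_slots :: "('p \<Rightarrow> nat) \<Rightarrow> 'p slot set" where
  "obs_slots \<nu> = case_prod Obs ` (SIGMA i:UNIV. {1..\<nu> i})"

lemma slots_iff [simp]:
  "Free k \<in> unobs_slots H \<mu> \<longleftrightarrow> k \<in> {1..\<mu> 0}"
  "Zero i k \<in> unobs_slots H \<mu> \<longleftrightarrow> i \<in> H \<and> k \<in> {1..\<mu> i}"
  "Conj i k \<in> unobs_slots H \<mu> \<longleftrightarrow> i \<in> H \<and> k \<in> {1..\<mu> i}"
  "Obs l k \<notin> unobs_slots H \<mu>"
  "Obs l k \<in> obs_slots \<nu> \<longleftrightarrow> k \<in> {1..\<nu> l}"
  "Free k \<notin> obs_slots \<nu>" "Zero i k \<notin> obs_slots \<nu>" "Conj i k \<notin> obs_slots \<nu>"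
  by (auto simp: unobs_slots_def obs_slots_def)

lemma inj_slots: "inj_on Free X" "inj_on (case_prod Zero) Y" "inj_on (case_prod Conj) Y"
  "inj_on (case_prod Obs) Z"
  by (auto intro!: inj_onI)

lemma finite_slots:
  "finite H \<Longrightarrow> finite (unobs_slots H \<mu>)" "finite (obs_slots (\<nu> :: 'p::finite \<Rightarrow> nat))"
  by (simp_all add: unobs_slots_def obs_slots_def)

lemma card_unobs_slots:
  assumes "finite H"
  shows "card (unobs_slots H \<mu> :: 'p slot set) = \<mu> 0 + (\<Sum>i\<in>H. 2 * \<mu> i)"
proof -
  let ?S = "SIGMA i:H. {1..\<mu> i}"
  let ?X = "Free ` {1..\<mu> 0} :: 'p slot set"
  let ?Y = "case_prod Zero ` ?S :: 'p slot set" and ?Z = "case_prod Conj ` ?S :: 'p slot set"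
  have fin: "finite ?S" using assms by simp
  have "card (?X \<union> (?Y \<union> ?Z)) = card ?X + card (?Y \<union> ?Z)"
    using fin by (intro card_Un_disjoint) auto
  also have "card (?Y \<union> ?Z) = card ?Y + card ?Z"
    using fin by (intro card_Un_disjoint) auto
  also have "card ?X + (card ?Y + card ?Z) = \<mu> 0 + ((\<Sum>i\<in>H. \<mu> i) + (\<Sum>i\<in>H. \<mu> i))"
    using assms by (simp add: card_image[OF inj_slots(1)] card_image[OF inj_slots(2)]
        card_image[OF inj_slots(3)])
  finally show ?thesis by (simp add: unobs_slots_def sum_distrib_left[symmetric])
qed

lemma card_obs_slots: "card (obs_slots \<nu>) = (\<Sum>i\<in>UNIV. \<nu> (i :: 'p::finite))"
  unfolding obs_slots_def by (simp add: card_image[OF inj_slots(4)])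

text \<open>The sets for \<open>Free\<close> and \<open>Obs\<close> admit real vectors only, so that
  after the choice of a transversal just the pairs \<open>Zero\<close> and \<open>Conj\<close>
  remain to be repaired. Those two sets are subspaces, as the exchange requires.\<close>

definition slot_vectors ::
  "time_domain \<Rightarrow> real^'n^'n \<Rightarrow> real^'m^'n \<Rightarrow> real^'n^'p \<Rightarrow> real^'m^'p \<Rightarrow>
   (nat \<Rightarrow> complex) \<Rightarrow> ('p \<Rightarrow> nat \<Rightarrow> real) \<Rightarrow> 'p slot \<Rightarrow> (complex^'n) set" where
  "slot_vectors T A B C D z lam s = (case s of
      Free k \<Rightarrow> real_unobservable T A B C D
    | Zero i k \<Rightarrow> \<R> A B C D (z i)
    | Conj i k \<Rightarrow> cnj_vec ` \<R> A B C D (z i)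
    | Obs i j \<Rightarrow> {v \<in> R_hat A B C D i (complex_of_real (lam i j)). cnj_vec v = v})"

text \<open>The slots of \<open>Free\<close>, and those of \<open>Zero i\<close> or
  \<open>Conj i\<close> for fixed \<open>i\<close>, all carry the same set. In Rado's condition a
  set \<open>J\<close> of slots can thus be enlarged to all slots of the groups it meets: the
  dimension stays the same and the cardinality can only grow. What is left is the assumed inequality
  for the groups that \<open>J\<close> meets.\<close>

lemma slot_transversal:
  fixes T :: time_domain
    and A :: "real^'n^'n" and B :: "real^'m^'n" and C :: "real^'n^'p" and D :: "real^'m^'p"
  assumes "right_invertible A B C D" "finite H" "0 \<notin> H"
    and card: "\<mu> 0 + (\<Sum>i\<in>H. 2 * \<mu> i) + (\<Sum>i\<in>UNIV. \<nu> i) = CARD('n)"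
    and dim: "\<And>Q0 Q Q' P. Q0 \<subseteq> {0} \<Longrightarrow> Q \<subseteq> H \<Longrightarrow> Q' \<subseteq> H \<Longrightarrow> P \<subseteq> (SIGMA i:UNIV. {1..\<nu> i}) \<Longrightarrow>
      (\<Sum>i\<in>Q0. \<mu> i) + (\<Sum>i\<in>Q. \<mu> i) + (\<Sum>i\<in>Q'. \<mu> i) + card P \<le>
      vec.dim ((\<Sum>i\<in>Q0. \<E> T A B C D z i) + (\<Sum>i\<in>Q. \<E> T A B C D z i)
        + (\<Sum>i\<in>Q'. cnj_vec ` \<E> T A B C D z i)
        + (\<Sum>(i, j)\<in>P. R_c A B C D i (complex_of_real (lam i j))))"
  shows "\<exists>x. inj_on x (unobs_slots H \<mu> \<union> obs_slots \<nu>) \<and>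
    vec.independent (x ` (unobs_slots H \<mu> \<union> obs_slots \<nu>)) \<and>
    (\<forall>s\<in>unobs_slots H \<mu> \<union> obs_slots \<nu>. x s \<in> slot_vectors T A B C D z lam s \<and>
      x (partner s) = cnj_vec (x s))"
proof -
  let ?I = "unobs_slots H \<mu> \<union> obs_slots \<nu>" and ?V = "slot_vectors T A B C D z lam"
  have fin: "finite ?I" using assms(2) by (simp add: finite_slots)
  have "\<exists>x. (\<forall>s\<in>?I. x s \<in> ?V s) \<and> inj_on x ?I \<and> vec.independent (x ` ?I)"
  proof (rule rado[OF fin])
    fix J assume J: "J \<subseteq> ?I"
    define Q0 where "Q0 = {i :: nat. i = 0 \<and> (\<exists>k. Free k \<in> J)}"
    define Q where "Q = {i. \<exists>k. Zero i k \<in> J}"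
    define Q' where "Q' = {i. \<exists>k. Conj i k \<in> J}"
    define P where "P = {(i, j). Obs i j \<in> J}"
    have sub: "Q0 \<subseteq> {0}" "Q \<subseteq> H" "Q' \<subseteq> H" "P \<subseteq> (SIGMA i:UNIV. {1..\<nu> i})"
      using J by (auto simp: Q0_def Q_def Q'_def P_def dest!: subsetD)
    have fins: "finite Q0" "finite Q" "finite Q'" "finite P"
      using sub assms(2) by (auto intro: finite_subset)
    let ?X1 = "(\<Union>i\<in>Q0. Free ` {1..\<mu> i}) :: 'p slot set"
    let ?X2 = "case_prod Zero ` (SIGMA i:Q. {1..\<mu> i}) :: 'p slot set"
    let ?X3 = "case_prod Conj ` (SIGMA i:Q'. {1..\<mu> i}) :: 'p slot set"
    let ?X4 = "case_prod Obs ` P"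
    have "s \<in> ?X1 \<union> (?X2 \<union> (?X3 \<union> ?X4))" if "s \<in> J" for s
      using that J by (cases s) (auto simp: Q0_def Q_def Q'_def P_def dest!: subsetD)
    then have "card J \<le> card (?X1 \<union> (?X2 \<union> (?X3 \<union> ?X4)))"
      using fins by (intro card_mono) auto
    also have "\<dots> \<le> card ?X1 + (card ?X2 + (card ?X3 + card ?X4))"
      using card_Un_le[of ?X1 "?X2 \<union> (?X3 \<union> ?X4)"] card_Un_le[of ?X2 "?X3 \<union> ?X4"]
        card_Un_le[of ?X3 ?X4] by linarith
    also have "\<dots> \<le> (\<Sum>i\<in>Q0. \<mu> i) + ((\<Sum>i\<in>Q. \<mu> i) + ((\<Sum>i\<in>Q'. \<mu> i) + card P))"
    proof (intro add_mono)
      show "card ?X1 \<le> (\<Sum>i\<in>Q0. \<mu> i)"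
        using card_UN_le[OF fins(1), of "\<lambda>i. Free ` {1..\<mu> i} :: 'p slot set"] by (simp add: card_image[OF inj_slots(1)])
    qed (use fins in \<open>simp_all add: card_image[OF inj_slots(2)] card_image[OF inj_slots(3)] card_image[OF inj_slots(4)]\<close>)
    also have "\<dots> \<le> vec.dim ((\<Sum>i\<in>Q0. \<E> T A B C D z i) + (\<Sum>i\<in>Q. \<E> T A B C D z i)
        + (\<Sum>i\<in>Q'. cnj_vec ` \<E> T A B C D z i)
        + (\<Sum>(i, j)\<in>P. R_c A B C D i (complex_of_real (lam i j))))"
      using dim[OF sub] by linarith
    also have "\<dots> \<le> vec.dim (\<Union>s\<in>J. ?V s)"
    \<comment> \<open>Restricting \<open>Free\<close> and \<open>Obs\<close> slots to real vectors
      costs no dimension, because these real vectors span the complex components.\<close>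
    proof (rule vec.dim_mono, intro set_plus_subset_span sum_of_sets_subset_span fins)
      have span: "vec.span (?V s) \<subseteq> vec.span (\<Union>s\<in>J. ?V s)" if "s \<in> J" for s
        using that by (intro vec.span_mono) blast
      show "\<E> T A B C D z i \<subseteq> vec.span (\<Union>s\<in>J. ?V s)" if "i \<in> Q0" for i
      proof -
        obtain k where k: "i = 0" "Free k \<in> J" using \<open>i \<in> Q0\<close> by (auto simp: Q0_def)
        have "\<E> T A B C D z 0 \<subseteq> vec.span (real_unobservable T A B C D)"
          unfolding \<E>_def using E_g_0_subset_span_real[OF assms(1)] vec.subspace_span
          by (rule vec.span_minimal)
        then show ?thesis using span[OF k(2)] k(1) by (simp add: slot_vectors_def)
      qed
      show "\<E> T A B C D z i \<subseteq> vec.span (\<Union>s\<in>J. ?V s)" if "i \<in> Q" for i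
      proof -
        obtain k where k: "Zero i k \<in> J" using \<open>i \<in> Q\<close> by (auto simp: Q_def)
        have "i \<noteq> 0" using subsetD[OF sub(2) that] assms(3) by (cases i) auto
        then show ?thesis using span[OF k] by (simp add: slot_vectors_def \<E>_def E_g_def)
      qed
      show "cnj_vec ` \<E> T A B C D z i \<subseteq> vec.span (\<Union>s\<in>J. ?V s)" if "i \<in> Q'" for i
      proof -
        obtain k where k: "Conj i k \<in> J" using \<open>i \<in> Q'\<close> by (auto simp: Q'_def)
        have "i \<noteq> 0" using subsetD[OF sub(3) that] assms(3) by (cases i) auto
        then have "\<E> T A B C D z i = \<R> A B C D (z i)"
          using subspace_\<R> by (simp add: \<E>_def E_g_def)
        then have "cnj_vec ` \<E> T A B C D z i = ?V (Conj i k)" by (simp add: slot_vectors_def)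
        then show ?thesis using span[OF k] vec.span_superset by blast
      qed
      show "(case t of (i, j) \<Rightarrow> R_c A B C D i (complex_of_real (lam i j))) \<subseteq> vec.span (\<Union>s\<in>J. ?V s)"
        if t: "t \<in> P" for t
      proof -
        obtain i j where ij: "t = (i, j)" "Obs i j \<in> J" using t by (auto simp: P_def)
        have "R_c A B C D i (complex_of_real (lam i j)) \<subseteq> vec.span (?V (Obs i j))"
          unfolding R_c_def slot_vectors_def slot.case
          by (intro vec.span_minimal R_hat_subset_span_real vec.subspace_span) simp
        then show ?thesis using span[OF ij(2)] ij(1) by simp
      qed
    qed
    finally show "card J \<le> vec.dim (\<Union>s\<in>J. ?V s)" .
  qed
  then obtain x0 where x0: "\<And>s. s \<in> ?I \<Longrightarrow> x0 s \<in> ?V s" "inj_on x0 ?I" "vec.independent (x0 ` ?I)"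
    by blast
  let ?S = "SIGMA i:H. {1..\<mu> i}"
  have cI: "card ?I = CARD('n)"
  proof -
    have "card ?I = card (unobs_slots H \<mu> :: 'p slot set) + card (obs_slots \<nu>)"
      using fin by (intro card_Un_disjoint) (auto simp: obs_slots_def)
    then show ?thesis using card assms(2) by (simp add: card_unobs_slots card_obs_slots)
  qed
  have fS: "finite ?S" using assms(2) by simp
  have disj: "case_prod Zero ` ?S \<inter> case_prod Conj ` ?S = ({} :: 'p slot set)"
    and subI: "case_prod Zero ` ?S \<union> case_prod Conj ` ?S \<subseteq> ?I" by auto
  have U: "vec.subspace (\<R> A B C D (z (fst t))) \<and> x0 (case_prod Zero t) \<in> \<R> A B C D (z (fst t)) \<and>
      cnj_vec (x0 (case_prod Conj t)) \<in> \<R> A B C D (z (fst t))" if t: "t \<in> ?S" for t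
  proof -
    obtain i k where ik: "t = (i, k)" "i \<in> H" "k \<in> {1..\<mu> i}" using t by auto
    have "x0 (Zero i k) \<in> ?V (Zero i k)" "x0 (Conj i k) \<in> ?V (Conj i k)"
      using ik by (auto intro!: x0(1))
    then show ?thesis using ik(1) by (auto simp: slot_vectors_def intro: subspace_\<R>)
  qed
  from conjugate_pairs_exchange[where U = "\<lambda>t. \<R> A B C D (z (fst t))",
      OF fin cI x0(2,3) fS inj_slots(2,3) disj subI U]
  obtain x where "inj_on x ?I \<and> vec.independent (x ` ?I) \<and>
    (\<forall>t\<in>?S. x (case_prod Zero t) \<in> \<R> A B C D (z (fst t)) \<and>
      x (case_prod Conj t) = cnj_vec (x (case_prod Zero t))) \<and>
    (\<forall>s. s \<notin> case_prod Zero ` ?S \<union> case_prod Conj ` ?S \<longrightarrow> x s = x0 s)"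
    by (rule exE)
  then have x: "inj_on x ?I" "vec.independent (x ` ?I)"
    "\<And>t. t \<in> ?S \<Longrightarrow> x (case_prod Zero t) \<in> \<R> A B C D (z (fst t)) \<and>
      x (case_prod Conj t) = cnj_vec (x (case_prod Zero t))"
    "\<And>s. s \<notin> case_prod Zero ` ?S \<union> case_prod Conj ` ?S \<Longrightarrow> x s = x0 s"
    by blast+
  have zc: "x (Zero i k) \<in> \<R> A B C D (z i)" "x (Conj i k) = cnj_vec (x (Zero i k))"
    if "i \<in> H" "k \<in> {1..\<mu> i}" for i k
    using x(3)[of "(i, k)"] that by simp_all
  have fo: "x (Free k) = x0 (Free k)" "x (Obs l k) = x0 (Obs l k)" for k l
    by (rule x(4), auto)+
  have V: "x s \<in> ?V s" if s: "s \<in> ?I" for s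
  proof (cases s)
    case (Free k)
    then show ?thesis using fo x0(1)[OF s] by simp
  next
    case (Zero i k)
    then show ?thesis using zc(1)[of i k] s by (simp add: slot_vectors_def)
  next
    case (Conj i k)
    then show ?thesis using zc[of i k] s by (simp add: slot_vectors_def)
  next
    case (Obs i k)
    then show ?thesis using fo x0(1)[OF s] by simp
  qed
  have "x (partner s) = cnj_vec (x s)" if s: "s \<in> ?I" for s
  proof (cases s)
    case (Free k)
    then show ?thesis using V[OF s] by (simp add: slot_vectors_def real_unobservable_def)
  next
    case (Zero i k)
    then show ?thesis using zc[of i k] s by simp
  next
    case (Conj i k)
    then show ?thesis using zc[of i k] s by simp
  next
    case (Obs i k)
    then show ?thesis using V[OF s] by (simp add: slot_vectors_def)
  qed
  then show ?thesis using x(1,2) V by (intro exI[of _ x]) blast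
qed

section \<open>Eigenvalues and inputs for the chosen vectors\<close>

lemma Re_vec_real: "cnj_vec u = u \<Longrightarrow> Re_vec u = u"
  by (simp add: Re_vec_def vec_eq_iff)

text \<open>The input attached to a real vector may be complex, which would spoil the reality of
  \<open>F\<close>. Taking real parts changes neither the vector nor the output.\<close>

lemma real_solution:
  assumes "s \<in> \<real>" "solves_pencil A B C D s v w y" "cnj_vec v = v" "cnj_vec y = y"
  shows "\<exists>w'. cnj_vec w' = w' \<and> solves_pencil A B C D s v w' y"
  using solves_pencil_Re_vec[OF assms(1,2)] assms(3,4)
  by (intro exI[of _ "Re_vec w"]) (simp add: Re_vec_real)

text \<open>The transversal supplies vectors only; here each slot receives an eigenvalue and an
  input compatible with \<open>partner\<close>. Inputs need not be unique, so the one at a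
  \<open>Conj\<close> slot is defined as the conjugate of the one at its \<open>Zero\<close> slot
  instead of being chosen separately.\<close>

lemma slot_eigenvalues_inputs:
  fixes T :: time_domain
    and A :: "real^'n^'n" and B :: "real^'m^'n" and C :: "real^'n^'p" and D :: "real^'m^'p"
    and x :: "'p slot \<Rightarrow> complex^'n" and H :: "nat set" and \<mu> :: "nat \<Rightarrow> nat" and \<nu> :: "'p \<Rightarrow> nat"
  defines "I \<equiv> unobs_slots H \<mu> \<union> obs_slots \<nu>"
  assumes family: "\<forall>s\<in>I. x s \<in> slot_vectors T A B C D z lam s \<and> x (partner s) = cnj_vec (x s)"
    and stable: "\<forall>i\<in>H. z i \<in> stable_region T"
      "\<forall>i. \<forall>j\<in>{1..\<nu> i}. complex_of_real (lam i j) \<in> stable_region T"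
  shows "\<exists>e w.
    (\<forall>s\<in>I. e s \<in> stable_region T \<and> e (partner s) = cnj (e s) \<and> w (partner s) = cnj_vec (w s)) \<and>
    (\<forall>s\<in>unobs_slots H \<mu>. solves_pencil A B C D (e s) (x s) (w s) 0) \<and>
    (\<forall>i. \<forall>j\<in>{1..\<nu> i}. e (Obs i j) = complex_of_real (lam i j) \<and>
      (\<exists>\<delta>. \<delta> \<noteq> 0 \<and> solves_pencil A B C D (e (Obs i j)) (x (Obs i j)) (w (Obs i j)) (\<delta> *s axis i 1))) \<and>
    (\<forall>i k. e (Zero i k) = z i \<and> e (Conj i k) = cnj (z i))"
proof -
  have x: "x s \<in> slot_vectors T A B C D z lam s" and partner: "x (partner s) = cnj_vec (x s)"
    if "s \<in> I" for s using family that by auto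
  have z: "z i \<in> stable_region T" if "i \<in> H" for i using stable(1) that by blast
  have lam: "complex_of_real (lam i j) \<in> stable_region T" if "j \<in> {1..\<nu> i}" for i j
    using stable(2) that by blast
  \<comment> \<open>The eigenvalue of a \<open>Free\<close> slot is not given in advance but depends
    on the vector, so it is chosen together with the input, as a pair.\<close>
  have "\<exists>ew. k \<in> {1..\<mu> 0} \<longrightarrow> fst ew \<in> stable_region T \<and> fst ew \<in> \<real> \<and> cnj_vec (snd ew) = snd ew \<and>
      solves_pencil A B C D (fst ew) (x (Free k)) (snd ew) 0" for k
  proof (cases "k \<in> {1..\<mu> 0}")
    case True
    then have "x (Free k) \<in> real_unobservable T A B C D"
      using x[of "Free k"] by (simp add: I_def slot_vectors_def)
    then obtain s w where s: "s \<in> stable_region T" "s \<in> \<real>" "cnj_vec (x (Free k)) = x (Free k)"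
      "solves_pencil A B C D s (x (Free k)) w 0"
      by (auto simp: real_unobservable_def \<R>_iff_solves)
    from real_solution[OF s(2,4,3)]
    obtain w' where "cnj_vec w' = w'" "solves_pencil A B C D s (x (Free k)) w' 0" by auto
    then show ?thesis using s(1,2) by (intro exI[of _ "(s, w')"]) simp
  qed blast
  then obtain f where f: "\<And>k. k \<in> {1..\<mu> 0} \<Longrightarrow> fst (f k) \<in> stable_region T \<and> fst (f k) \<in> \<real> \<and>
      cnj_vec (snd (f k)) = snd (f k) \<and> solves_pencil A B C D (fst (f k)) (x (Free k)) (snd (f k)) 0"
    using choice[of "\<lambda>k ew. k \<in> {1..\<mu> 0} \<longrightarrow> fst ew \<in> stable_region T \<and> fst ew \<in> \<real> \<and>
      cnj_vec (snd ew) = snd ew \<and> solves_pencil A B C D (fst ew) (x (Free k)) (snd ew) 0"] by auto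
  have "\<exists>w. i \<in> H \<and> k \<in> {1..\<mu> i} \<longrightarrow> solves_pencil A B C D (z i) (x (Zero i k)) w 0" for i k
    using x[of "Zero i k"] by (auto simp: I_def slot_vectors_def \<R>_iff_solves)
  then obtain g where g: "\<And>i k. i \<in> H \<Longrightarrow> k \<in> {1..\<mu> i} \<Longrightarrow>
      solves_pencil A B C D (z i) (x (Zero i k)) (g i k) 0"
    by metis
  have "\<exists>w. j \<in> {1..\<nu> i} \<longrightarrow> cnj_vec w = w \<and> (\<exists>\<delta>. \<delta> \<noteq> 0 \<and>
      solves_pencil A B C D (complex_of_real (lam i j)) (x (Obs i j)) w (\<delta> *s axis i 1))" for i j
  proof (cases "j \<in> {1..\<nu> i}")
    case True
    then have "x (Obs i j) \<in> R_hat A B C D i (complex_of_real (lam i j))" "cnj_vec (x (Obs i j)) = x (Obs i j)"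
      using x[of "Obs i j"] by (simp_all add: I_def slot_vectors_def)
    then obtain w \<delta> where w: "\<delta> \<noteq> 0" "cnj_vec (x (Obs i j)) = x (Obs i j)"
      "solves_pencil A B C D (complex_of_real (lam i j)) (x (Obs i j)) w (complex_of_real \<delta> *s axis i 1)"
      by (auto simp: R_hat_iff_solves)
    have "\<exists>w'. cnj_vec w' = w' \<and> solves_pencil A B C D (complex_of_real (lam i j)) (x (Obs i j)) w'
        (complex_of_real \<delta> *s axis i 1)"
      using w by (intro real_solution[OF _ w(3)]) (simp_all add: cnj_vec_scale)
    then obtain w' where w': "cnj_vec w' = w'"
      "solves_pencil A B C D (complex_of_real (lam i j)) (x (Obs i j)) w' (complex_of_real \<delta> *s axis i 1)"
      by blast
    have "complex_of_real \<delta> \<noteq> 0" using w(1) by simp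
    with w' show ?thesis by blast
  qed blast
  then have "\<forall>i. \<exists>h. \<forall>j. j \<in> {1..\<nu> i} \<longrightarrow> cnj_vec (h j) = h j \<and> (\<exists>\<delta>. \<delta> \<noteq> 0 \<and>
      solves_pencil A B C D (complex_of_real (lam i j)) (x (Obs i j)) (h j) (\<delta> *s axis i 1))"
    by (intro allI choice)
  from choice[OF this]
  obtain h where h: "\<And>i j. j \<in> {1..\<nu> i} \<Longrightarrow> cnj_vec (h i j) = h i j \<and> (\<exists>\<delta>. \<delta> \<noteq> 0 \<and>
      solves_pencil A B C D (complex_of_real (lam i j)) (x (Obs i j)) (h i j) (\<delta> *s axis i 1))"
    by blast
  define e where "e s = (case s of Free k \<Rightarrow> fst (f k) | Zero i k \<Rightarrow> z i | Conj i k \<Rightarrow> cnj (z i)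
    | Obs i j \<Rightarrow> complex_of_real (lam i j))" for s
  define w where "w s = (case s of Free k \<Rightarrow> snd (f k) | Zero i k \<Rightarrow> g i k | Conj i k \<Rightarrow> cnj_vec (g i k)
    | Obs i j \<Rightarrow> h i j)" for s
  have cnj_stable: "cnj s \<in> stable_region T" if "s \<in> stable_region T" for s
    using that by (cases T) (simp_all add: stable_region_def)
  have "e s \<in> stable_region T \<and> e (partner s) = cnj (e s) \<and> w (partner s) = cnj_vec (w s)"
    if s: "s \<in> I" for s
  proof (cases s)
    case (Free k)
    then show ?thesis using f[of k] s by (simp add: I_def e_def w_def Reals_cnj_iff)
  next
    case (Zero i k)
    then show ?thesis using z[of i] s by (simp add: I_def e_def w_def)
  next
    case (Conj i k)
    then show ?thesis using z[of i] s by (simp add: I_def e_def w_def cnj_stable)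
  next
    case (Obs i k)
    then show ?thesis using h[of k i] lam[of k i] s by (simp add: I_def e_def w_def)
  qed
  moreover have "solves_pencil A B C D (e s) (x s) (w s) 0" if s: "s \<in> unobs_slots H \<mu>" for s
  proof (cases s)
    case (Free k)
    then show ?thesis using f[of k] s by (simp add: e_def w_def)
  next
    case (Zero i k)
    then show ?thesis using g[of i k] s by (simp add: e_def w_def)
  next
    case (Conj i k)
    then have ik: "i \<in> H" "k \<in> {1..\<mu> i}" using s by simp_all
    have "x (Conj i k) = cnj_vec (x (Zero i k))"
      using partner[of "Zero i k"] ik by (simp add: I_def)
    then show ?thesis using solves_pencil_cnj[OF g[OF ik]] Conj by (simp add: e_def w_def)
  next
    case (Obs i k)
    then show ?thesis using s by simp
  qed
  moreover have "e (Obs i j) = complex_of_real (lam i j) \<and>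
      (\<exists>\<delta>. \<delta> \<noteq> 0 \<and> solves_pencil A B C D (e (Obs i j)) (x (Obs i j)) (w (Obs i j)) (\<delta> *s axis i 1))"
    if "j \<in> {1..\<nu> i}" for i j
    using h[OF that] by (simp add: e_def w_def)
  moreover have "e (Zero i k) = z i \<and> e (Conj i k) = cnj (z i)" for i k
    by (simp add: e_def)
  ultimately show ?thesis by (intro exI[of _ e] exI[of _ w]) blast
qed

section \<open>The feedback and its decoupling eigenbasis\<close>

lemma partner_slots:
  "s \<in> unobs_slots H \<mu> \<Longrightarrow> partner s \<in> unobs_slots H \<mu>"
  "s \<in> obs_slots \<nu> \<Longrightarrow> partner s = s"
  by (cases s; simp)+

text \<open>The prescription \<open>F x_s = w_s\<close> turns the pencil equations into the
  eigenvector and output equations of the closed loop. \<open>F\<close> is real because conjugation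
  acts on vectors and inputs through \<open>partner\<close>. The rest is a renumbering of the slots
  as pairs of a group and a position.\<close>

lemma problem_1B_solvable_if_slot_family:
  fixes T :: time_domain
    and A :: "real^'n^'n" and B :: "real^'m^'n" and C :: "real^'n^'p" and D :: "real^'m^'p"
    and x :: "'p slot \<Rightarrow> complex^'n" and H :: "nat set" and \<mu> :: "nat \<Rightarrow> nat" and \<nu> :: "'p \<Rightarrow> nat"
  defines "I \<equiv> unobs_slots H \<mu> \<union> obs_slots \<nu>"
  assumes rank: "rank (eval_mat (system_pencil A B C D) (complex_of_real (dc_point T))) = CARD('n + 'p)"
    and "finite H" and \<nu>0: "\<mu> 0 + (\<Sum>i\<in>H. 2 * \<mu> i) = \<nu>0" and card: "\<nu>0 + (\<Sum>i\<in>UNIV. \<nu> i) = CARD('n)"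
    and inj: "inj_on x I" and ind: "vec.independent (x ` I)"
    and family: "\<forall>s\<in>I. x s \<in> slot_vectors T A B C D z lam s \<and> x (partner s) = cnj_vec (x s)"
    and zH: "\<forall>i\<in>H. z i \<in> stable_region T - \<real>"
    and assigned: "\<forall>i. \<forall>j\<in>{1..\<nu> i}. complex_of_real (lam i j) \<in> stable_region T - invariant_zeros A B C D"
  shows "problem_1B_solvable T A B C D \<nu>0 \<nu> lam"
proof -
  have partner: "x (partner s) = cnj_vec (x s)" if "s \<in> I" for s using family that by blast
  have z: "z i \<in> stable_region T - \<real>" if "i \<in> H" for i using zH that by blast
  have lam: "complex_of_real (lam i j) \<in> stable_region T - invariant_zeros A B C D"
    if "j \<in> {1..\<nu> i}" for i j using assigned that by blast
  have zs: "\<forall>i\<in>H. z i \<in> stable_region T" using z by blast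
  have ls: "\<forall>i. \<forall>j\<in>{1..\<nu> i}. complex_of_real (lam i j) \<in> stable_region T" using lam by blast
  obtain e w where ew':
    "(\<forall>s\<in>I. e s \<in> stable_region T \<and> e (partner s) = cnj (e s) \<and> w (partner s) = cnj_vec (w s)) \<and>
    (\<forall>s\<in>unobs_slots H \<mu>. solves_pencil A B C D (e s) (x s) (w s) 0) \<and>
    (\<forall>i. \<forall>j\<in>{1..\<nu> i}. e (Obs i j) = complex_of_real (lam i j) \<and>
      (\<exists>\<delta>. \<delta> \<noteq> 0 \<and> solves_pencil A B C D (e (Obs i j)) (x (Obs i j)) (w (Obs i j)) (\<delta> *s axis i 1))) \<and>
    (\<forall>i k. e (Zero i k) = z i \<and> e (Conj i k) = cnj (z i))"
    using slot_eigenvalues_inputs[of H \<mu> \<nu> x T A B C D z lam, folded I_def, OF family zs ls]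
    by (elim exE) (rule that)
  have ew: "e s \<in> stable_region T" "e (partner s) = cnj (e s)" "w (partner s) = cnj_vec (w s)"
    if "s \<in> I" for s
    using ew'[THEN conjunct1, THEN bspec, OF that] by simp_all
  note un = ew'[THEN conjunct2, THEN conjunct1, THEN bspec]
    and ob = ew'[THEN conjunct2, THEN conjunct2, THEN conjunct1, THEN spec, THEN bspec]
  have ez: "e (Zero i k) = z i" "e (Conj i k) = cnj (z i)" for i k
    using ew'[THEN conjunct2, THEN conjunct2, THEN conjunct2, THEN spec, THEN spec, of i k] by simp_all
  have fin: "finite I" using assms(3) by (simp add: I_def finite_slots)
  have cI: "card I = CARD('n)"
  proof -
    have "card I = card (unobs_slots H \<mu> :: 'p slot set) + card (obs_slots \<nu>)"
      using fin unfolding I_def by (intro card_Un_disjoint) (auto simp: obs_slots_def)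
    then show ?thesis using card \<nu>0 assms(3) by (simp add: card_unobs_slots card_obs_slots)
  qed
  obtain h :: "'n \<Rightarrow> 'p slot" where h: "bij_betw h UNIV I"
    using finite_same_card_bij[of "UNIV :: 'n set" I] fin cI by auto
  have rng: "range h = I" using h by (simp add: bij_betw_def)
  have hI: "h k \<in> I" for k using rng by blast
  have hx: "inj (x \<circ> h)" "vec.independent (range (x \<circ> h))"
    using independent_family_reindex[OF h, of x] inj ind by simp_all
  have pI: "partner s \<in> I" if "s \<in> I" for s
    using that partner_slots[of s] unfolding I_def by fastforce
  \<comment> \<open>This is \<open>partner\<close> carried over to the index type of the matrix by
    the bijection \<open>h\<close>.\<close>
  define \<pi> where "\<pi> k = inv h (partner (h k))" for k
  have h\<pi>: "h (\<pi> k) = partner (h k)" for k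
    unfolding \<pi>_def using pI[OF hI[of k]] rng by (intro f_inv_into_f) simp
  have cx: "cnj_vec ((x \<circ> h) k) = (x \<circ> h) (\<pi> k)" and cw: "cnj_vec ((w \<circ> h) k) = (w \<circ> h) (\<pi> k)" for k
    using partner[OF hI[of k]] ew(3)[OF hI[of k]] by (simp_all add: h\<pi>)
  obtain F :: "real^'n^'m" where Fh: "\<forall>k. cmat F *v (x \<circ> h) k = (w \<circ> h) k"
    using real_matrix_of_conjugate_family[where X = "x \<circ> h" and W = "w \<circ> h" and \<pi> = \<pi>, OF hx cx cw] ..
  have F: "cmat F *v x s = w s" if "s \<in> I" for s
  proof -
    obtain k where "s = h k" using \<open>s \<in> I\<close> rng by blast
    then show ?thesis using Fh by simp
  qed
  have unI: "s \<in> I" if "s \<in> unobs_slots H \<mu>" for s using that by (simp add: I_def)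
  have obI: "Obs i j \<in> I" if "j \<in> {1..\<nu> i}" for i j using that by (simp add: I_def)
  have closed: "cmat (A + B ** F) *v x s = e s *s x s" "cmat (C + D ** F) *v x s = y"
    if "s \<in> I" "solves_pencil A B C D (e s) (x s) (w s) y" for s y
    using that by (simp_all add: cmat_feedback_mult F solves_pencil_def)
  have un_closed: "cmat (A + B ** F) *v x s = e s *s x s" "cmat (C + D ** F) *v x s = 0"
    if "s \<in> unobs_slots H \<mu>" for s
    using closed[OF unI[OF that] un[OF that]] by simp_all
  have ob_closed: "cmat (A + B ** F) *v x (Obs i j) = e (Obs i j) *s x (Obs i j)"
    "\<exists>\<delta>. \<delta> \<noteq> 0 \<and> cmat (C + D ** F) *v x (Obs i j) = \<delta> *s axis i 1"
    if "j \<in> {1..\<nu> i}" for i j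
    using closed[OF obI[OF that]] ob[OF that] by blast+
  have eig: "cmat (A + B ** F) *v x s = e s *s x s" if "s \<in> I" for s
  proof (cases "s \<in> unobs_slots H \<mu>")
    case False
    then have "s \<in> obs_slots \<nu>" using that by (simp add: I_def)
    then show ?thesis using ob_closed(1) by (auto simp: obs_slots_def)
  qed (rule un_closed)
  then have eigh: "cmat (A + B ** F) *v (x \<circ> h) k = (e \<circ> h) k *s (x \<circ> h) k" for k
    using hI by simp
  have stable: "(e \<circ> h) k \<in> stable_region T" for k using ew(1)[OF hI] by simp
  have "eigenvalues (A + B ** F) \<subseteq> stable_region T"
    using eigenvalues_subset_eigenbasis[where X = "x \<circ> h" and e = "e \<circ> h", OF hx eigh] stable by blast
  moreover obtain G where "static_gain T A B C D F ** G = mat 1" "tracks_constant_references T A B C D F G"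
    using tracking_gain_exists[where X = "x \<circ> h" and e = "e \<circ> h", OF rank hx eigh stable] by blast
  moreover have "\<exists>ev v. decoupling_eigenbasis A B C D F (case_option \<nu>0 \<nu>) ev v \<and>
    (\<forall>i. \<forall>j\<in>{1..\<nu> i}. ev (Some i) j = complex_of_real (lam i j) \<and> ev (Some i) j \<notin> invariant_zeros A B C D)"
  proof -
    \<comment> \<open>Any enumeration of the unobservable slots will do, since the conjugate of an
      eigenvector is only required to occur somewhere in the same group.\<close>
    have "card (unobs_slots H \<mu> :: 'p slot set) = card {1..\<nu>0}"
      using \<nu>0 assms(3) by (simp add: card_unobs_slots)
    then obtain u :: "nat \<Rightarrow> 'p slot" where u: "bij_betw u {1..\<nu>0} (unobs_slots H \<mu>)"
      using finite_same_card_bij[of "{1..\<nu>0}" "unobs_slots H \<mu> :: 'p slot set"] finite_slots(1)[OF assms(3)]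
      by auto
    have uI: "u j \<in> unobs_slots H \<mu>" if "j \<in> {1..\<nu>0}" for j using u that by (auto simp: bij_betw_def)
    define K where "K = (SIGMA k:UNIV. {1..case_option \<nu>0 \<nu> k})"
    define \<sigma> where "\<sigma> k j = (case k of None \<Rightarrow> u j | Some i \<Rightarrow> Obs i j)" for k j
    have \<sigma>K: "bij_betw (\<lambda>(k, j). \<sigma> k j) K I"
    proof (rule bij_betw_imageI)
      have nu: "u j \<noteq> Obs i k" if "j \<in> {1..\<nu>0}" for i j k using uI[OF that] by auto
      show "inj_on (\<lambda>(k, j). \<sigma> k j) K"
      proof (rule inj_onI, clarify)
        fix k j k' j' assume K: "(k, j) \<in> K" "(k', j') \<in> K" and eq: "\<sigma> k j = \<sigma> k' j'"
        show "k = k' \<and> j = j'"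
        proof (cases k)
          case None
          show ?thesis
          proof (cases k')
            case None
            then show ?thesis using \<open>k = None\<close> eq K u
              by (auto simp: \<sigma>_def K_def bij_betw_def dest: inj_onD)
          next
            case (Some i')
            then show ?thesis using \<open>k = None\<close> eq K nu[of j i' j'] by (simp add: \<sigma>_def K_def)
          qed
        next
          case (Some i)
          show ?thesis
          proof (cases k')
            case None
            then show ?thesis using \<open>k = Some i\<close> eq K nu[of j' i j] by (simp add: \<sigma>_def K_def)
          next
            case (Some i')
            then show ?thesis using \<open>k = Some i\<close> eq by (simp add: \<sigma>_def)
          qed
        qed
      qed
      show "(\<lambda>(k, j). \<sigma> k j) ` K = I"
      proof (intro equalityI subsetI)
        fix s assume "s \<in> (\<lambda>(k, j). \<sigma> k j) ` K"
        then obtain k j where kj: "s = \<sigma> k j" "j \<in> {1..case_option \<nu>0 \<nu> k}" by (auto simp: K_def)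
        then show "s \<in> I" using uI[of j] unI obI by (cases k) (auto simp: \<sigma>_def)
      next
        fix s assume "s \<in> I"
        then consider "s \<in> unobs_slots H \<mu>" | "s \<in> obs_slots \<nu>" by (auto simp: I_def)
        then show "s \<in> (\<lambda>(k, j). \<sigma> k j) ` K"
        proof cases
          case 1
          then obtain j where "j \<in> {1..\<nu>0}" "s = u j" using bij_betw_imp_surj_on[OF u] by blast
          then show ?thesis by (intro image_eqI[of _ _ "(None, j)"]) (simp_all add: \<sigma>_def K_def)
        next
          case 2
          then obtain i j where "j \<in> {1..\<nu> i}" "s = Obs i j" by (auto simp: obs_slots_def)
          then show ?thesis by (intro image_eqI[of _ _ "(Some i, j)"]) (simp_all add: \<sigma>_def K_def)
        qed
      qed
    qed
    define v where "v k j = x (\<sigma> k j)" for k j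
    define ev where "ev k j = e (\<sigma> k j)" for k j
    have \<sigma>I: "\<sigma> k j \<in> I" if "j \<in> {1..case_option \<nu>0 \<nu> k}" for k j
      using bij_betwE[OF \<sigma>K] that by (force simp: K_def)
    have comp: "(\<lambda>(k, j). v k j) = x \<circ> (\<lambda>(k, j). \<sigma> k j)" by (auto simp: v_def)
    have img: "(\<lambda>(k, j). v k j) ` K = x ` I"
      unfolding comp image_comp[symmetric] using \<sigma>K by (simp add: bij_betw_def)
    have "inj_on (\<lambda>(k, j). v k j) K"
      unfolding comp using \<sigma>K inj by (intro comp_inj_on) (simp_all add: bij_betw_def)
    moreover have "vec.span (x ` I) = UNIV"
    proof -
      have "vec.dim (UNIV :: (complex^'n) set) \<le> card (x ` I)"
        unfolding vec_dim_card using inj cI by (simp only: card_image)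
      then show ?thesis using vec.card_ge_dim_independent[OF _ ind, of UNIV] by auto
    qed
    moreover have real: "cnj_vec (v k j) = v k j"
      if j: "j \<in> {1..case_option \<nu>0 \<nu> k}" "ev k j \<in> \<real>" for k j
    proof -
      \<comment> \<open>A real eigenvalue rules out \<open>Zero\<close> and \<open>Conj\<close>
        slots, and all other slots are fixed by \<open>partner\<close>, so their vectors are
        real.\<close>
      have nr: "z i \<notin> \<real>" "cnj (z i) \<notin> \<real>" if "i \<in> H" for i
        using z[OF that] by (auto simp: Reals_cnj_iff)
      have "partner (\<sigma> k j) = \<sigma> k j"
      proof (cases "\<sigma> k j")
        case (Zero i l)
        then show ?thesis using \<sigma>I[OF j(1)] j(2) nr[of i] by (simp add: I_def ev_def ez)
      next
        case (Conj i l)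
        then show ?thesis using \<sigma>I[OF j(1)] j(2) nr[of i] by (simp add: I_def ev_def ez)
      qed simp_all
      then show ?thesis using partner[OF \<sigma>I[OF j(1)]] by (simp add: v_def)
    qed
    \<comment> \<open>Assigned eigenvalues are real, so a nonreal one belongs to an unobservable
      slot. Its partner is unobservable too, hence in the same group.\<close>
    moreover have "\<exists>j'\<in>{1..case_option \<nu>0 \<nu> k}. ev k j' = cnj (ev k j) \<and> v k j' = cnj_vec (v k j)"
      if j: "j \<in> {1..case_option \<nu>0 \<nu> k}" "ev k j \<notin> \<real>" for k j
    proof (cases k)
      case None
      then have "u j \<in> unobs_slots H \<mu>" using j(1) uI by simp
      then have "partner (u j) \<in> u ` {1..\<nu>0}" using u partner_slots(1) by (simp add: bij_betw_def)
      then obtain j' where "j' \<in> {1..\<nu>0}" "u j' = partner (u j)" by auto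
      then show ?thesis
        using None ew(2)[OF unI[OF \<open>u j \<in> unobs_slots H \<mu>\<close>]] partner[OF unI[OF \<open>u j \<in> unobs_slots H \<mu>\<close>]]
        by (intro bexI[of _ j']) (simp_all add: v_def ev_def \<sigma>_def)
    next
      case (Some i)
      then have "ev k j \<in> \<real>" using j(1) ob[of j i] by (simp add: ev_def \<sigma>_def)
      then show ?thesis using j(2) by simp
    qed
    moreover have "cmat (A + B ** F) *v v k j = ev k j *s v k j" if "j \<in> {1..case_option \<nu>0 \<nu> k}" for k j
      unfolding v_def ev_def by (rule eig[OF \<sigma>I[OF that]])
    moreover have "cmat (C + D ** F) *v v None j = 0" if "j \<in> {1..\<nu>0}" for j
      using un_closed(2)[OF uI[OF that]] by (simp add: v_def \<sigma>_def)
    moreover have "\<exists>\<delta>. \<delta> \<noteq> 0 \<and> cmat (C + D ** F) *v v (Some i) j = \<delta> *s axis i 1" if "j \<in> {1..\<nu> i}" for i j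
      using ob_closed(2)[OF that] by (simp add: v_def \<sigma>_def)
    ultimately have "decoupling_eigenbasis A B C D F (case_option \<nu>0 \<nu>) ev v"
      unfolding decoupling_eigenbasis_def Let_def K_def[symmetric] img using ind
      by (simp only: option.case) blast
    moreover have "ev (Some i) j = complex_of_real (lam i j) \<and> ev (Some i) j \<notin> invariant_zeros A B C D"
      if "j \<in> {1..\<nu> i}" for i j
      using ob[OF that] lam[OF that] by (simp add: ev_def \<sigma>_def)
    ultimately show ?thesis by blast
  qed
  ultimately show ?thesis unfolding problem_1B_solvable_def by blast
qed

theorem theorem20:
  fixes T :: time_domain
    and A :: "real^'n^'n" and B :: "real^'m^'n" and C :: "real^'n^'p" and D :: "real^'m^'p"
    and \<nu>0 c :: nat and \<nu> :: "'p \<Rightarrow> nat" and lam :: "'p \<Rightarrow> nat \<Rightarrow> real" and z :: "nat \<Rightarrow> complex"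
  assumes "right_invertible A B C D"
    and "stabilizable T A B"
    and "complex_of_real (dc_point T) \<notin> invariant_zeros A B C D"
    and "\<forall>s \<in> invariant_zeros A B C D \<inter> stable_region T.
           algebraic_multiplicity s (system_pencil A B C D)
           = geometric_multiplicity s (system_pencil A B C D)"
    and "bij_betw z {1..2 * c} (nonreal_minimum_phase_zeros T A B C D)"
    and "\<forall>i\<in>{1..2 * c}. odd i \<longrightarrow> z (i + 1) = cnj (z i)"
    and "\<nu>0 + (\<Sum>i\<in>UNIV. \<nu> i) = CARD('n)"
    and "\<forall>i. \<forall>j\<in>{1..\<nu> i}. complex_of_real (lam i j) \<in> stable_region T - invariant_zeros A B C D"
  shows "problem_1B_solvable T A B C D \<nu>0 \<nu> lam \<longleftrightarrow>
    (\<exists>\<mu> :: nat \<Rightarrow> nat.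
       \<mu> 0 + (\<Sum>i | i \<in> {1..2 * c} \<and> odd i. 2 * \<mu> i) = \<nu>0 \<and>
       (\<forall>Q0 \<in> Pow {0}. \<forall>Q \<in> Pow {i \<in> {1..2 * c}. odd i}. \<forall>Q' \<in> Pow {i \<in> {1..2 * c}. odd i}.
        \<forall>P \<in> Pow (SIGMA i:UNIV. {1..\<nu> i}).
          vec.dim ((\<Sum>i\<in>Q0. \<E> T A B C D z i)
                   + (\<Sum>i\<in>Q. \<E> T A B C D z i)
                   + (\<Sum>i\<in>Q'. cnj_vec ` \<E> T A B C D z i)
                   + (\<Sum>(i, j)\<in>P. R_c A B C D i (complex_of_real (lam i j))))
          \<ge> (\<Sum>i\<in>Q0. \<mu> i) + (\<Sum>i\<in>Q. \<mu> i) + (\<Sum>i\<in>Q'. \<mu> i) + card P))"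
    (is "?solvable \<longleftrightarrow> ?condition")
proof
  assume ?solvable
  from dimension_condition_necessary[OF assms(5,6) this] show ?condition by simp
next
  let ?H = "{i \<in> {1..2 * c}. odd i}"
  assume ?condition
  then obtain \<mu> :: "nat \<Rightarrow> nat" where \<mu>: "\<mu> 0 + (\<Sum>i\<in>?H. 2 * \<mu> i) = \<nu>0"
    and dim: "\<And>Q0 Q Q' P. Q0 \<subseteq> {0} \<Longrightarrow> Q \<subseteq> ?H \<Longrightarrow> Q' \<subseteq> ?H \<Longrightarrow> P \<subseteq> (SIGMA i:UNIV. {1..\<nu> i}) \<Longrightarrow>
      (\<Sum>i\<in>Q0. \<mu> i) + (\<Sum>i\<in>Q. \<mu> i) + (\<Sum>i\<in>Q'. \<mu> i) + card P \<le>
      vec.dim ((\<Sum>i\<in>Q0. \<E> T A B C D z i) + (\<Sum>i\<in>Q. \<E> T A B C D z i)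
        + (\<Sum>i\<in>Q'. cnj_vec ` \<E> T A B C D z i)
        + (\<Sum>(i, j)\<in>P. R_c A B C D i (complex_of_real (lam i j))))"
    by (auto simp only: Pow_iff Ball_def)
  have H: "finite ?H" "0 \<notin> ?H" by simp_all
  have zH: "\<forall>i\<in>?H. z i \<in> stable_region T - \<real>"
    using bij_betwE[OF assms(5)] by (simp add: nonreal_minimum_phase_zeros_def)
  have card: "\<mu> 0 + (\<Sum>i\<in>?H. 2 * \<mu> i) + (\<Sum>i\<in>UNIV. \<nu> i) = CARD('n)"
    using \<mu> assms(7) by simp
  \<comment> \<open>Solvability of the equilibrium equations for every reference, and with it the
    existence of \<open>G\<close>, rests on this rank.\<close>
  have rank: "rank (eval_mat (system_pencil A B C D) (complex_of_real (dc_point T))) = CARD('n + 'p)"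
    by (rule full_row_rank_if_not_invariant_zero[OF assms(1,3)])
  obtain x where x: "inj_on x (unobs_slots ?H \<mu> \<union> obs_slots \<nu>)"
    "vec.independent (x ` (unobs_slots ?H \<mu> \<union> obs_slots \<nu>))"
    "\<forall>s\<in>unobs_slots ?H \<mu> \<union> obs_slots \<nu>. x s \<in> slot_vectors T A B C D z lam s \<and>
      x (partner s) = cnj_vec (x s)"
    using slot_transversal[OF assms(1) H card dim] by blast
  show ?solvable
    by (rule problem_1B_solvable_if_slot_family[OF rank H(1) \<mu> assms(7) x zH assms(8)])
qed

end
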